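(* Let $\mathcal{G}$ be an analytically tame stuff type, and suppose $F:\mathcal{G}\to p_0(Z)+p_1(Z)\mathcal{G}+\cdots+p_m(Z)\mathcal{G}^m$ is a nested equivalence. Let $P_F(z)=p_0(1)+p_1(1)z+\cdots+p_m(1)z^m\in\mathbb{Z}[z]$ be the structural polynomial associated with $F$. Then $\chi_a(\mathcal{G})$ is a fixed point of $P_F(z)$, i.e. $\chi_a(\mathcal{G})=P_F(\chi_a(\mathcal{G}))$.
   Context: Standing assumptions: every groupoid $\mathcal{G}$ has a countable set $[\mathcal{G}]$ of isomorphism classes and finite automorphism groups. Its groupoid cardinality is $\chi(\mathcal{G})=\sum_{[x]\in[\mathcal{G}]}\frac{1}{\#\mathrm{Aut}(x)}\in[0,\infty]$, and it is tame if $\chi(\mathcal{G})<\infty$. Stuff types: let $\mathfrak{Fin}$ be the groupoid of finite sets and bijections. A stuff type is a groupoid $\mathcal{G}$ with a functor $\mathbf{X}:\mathcal{G}\to\mathfrak{Fin}$. Its $n$th graded component $\mathcal{G}_n$ is the full subgroupoid on the objects sent to $n$-element sets, so $\mathcal{G}=\coprod_{n\ge0}\mathcal{G}_n$. A morphism from $\mathbf{X}:\mathcal{G}\to\mathfrak{Fin}$ to $\mathbf{Y}:\mathcal{H}\to\mathfrak{Fin}$ is a functor $T:\mathcal{G}\to\mathcal{H}$ with a natural isomorphism $\tau:\mathbf{X}\Rightarrow\mathbf{Y}\circ T$; it is an equivalence of stuff types (written $\cong$) if $T$ is an equivalence of categories. Operations: the sum $\mathcal{G}+\mathcal{H}$ is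 $\mathcal{G}\sqcup\mathcal{H}$ with the functor given by $\mathbf{X}$ on $\mathcal{G}$ and $\mathbf{Y}$ on $\mathcal{H}$; the additive identity is the empty stuff type. The (partitional) product $\mathcal{G}\cdot\mathcal{H}$ is $\mathcal{G}\times\mathcal{H}$ with the functor $(x,y)\mapsto\mathbf{X}(x)\sqcup\mathbf{Y}(y)$ (and the induced bijections on morphisms). $\mathcal{G}^i$ denotes the $i$-fold partitional product. $\mathbb{1}$ is the stuff type with a single object and a single morphism, with the object mapped to $\varnothing$. For $k\in\mathbb{N}$, $Z^k$ is the stuff type taking totally ordered $k$-element sets (with order-preserving bijections as morphisms) to their underlying sets. For $p(z)=a_0+a_1z+\cdots+a_kz^k\in\mathbb{N}[z]$, set $p(Z)=a_0\mathbb{1}+a_1Z+\cdots+a_kZ^k$, where $a_iZ^i$ is the sum of $a_i$ copies of $Z^i$. Analytic tameness: a stuff type is relatively tame if every $\mathcal{G}_n$ is tame; its generating series is then $\mathcal{G}(z)=\sum_{n\ge0}\chi(\mathcal{G}_n)z^n$. A relatively tame stuff type is analytically tame if $\mathcal{G}(z)$, viewed as a function of the complex variable $z$, is analytic in a neighborhood of $z=0$ and admits a unique analytic continuation to $z=1$ (analytic continuation being along paths in $\mathbb{C}$ from $0$ to $1$, with the value at $z=1$ independent of the continuation). Its analytic groupoid cardinality $\chi_a(\mathcal{G})\in\mathbb{C}$ is the value at $z=1$ of this continuation. Nested equivalence: an equivalence of stuff types $F:\mathcal{G}\to p_0(Z)+p_1(Z)\mathcal{G}+\cdots+p_m(Z)\mathcal{G}^m$,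 where $p_0,\dots,p_m$ are polynomials in $z$ with coefficients in $\{0,1\}\subset\mathbb{N}$ and $p_m$ is not the zero polynomial. In the structural polynomial $P_F$, the numbers $p_i(1)$ are evaluated in the integers. *)

theory Defs
  imports "HOL-Analysis.Analysis" "HOL-Computational_Algebra.Computational_Algebra"
begin

section \<open>Groupoids, functors, equivalences\<close>

record ('o, 'm) cat =
  obj :: "'o set"
  arr :: "'m set"
  src :: "'m \<Rightarrow> 'o"
  tgt :: "'m \<Rightarrow> 'o"
  idn :: "'o \<Rightarrow> 'm"
  cmp :: "'m \<Rightarrow> 'm \<Rightarrow> 'm"  \<comment> \<open>\<open>cmp C g f\<close> is "g after f", meaningful if \<open>tgt C f = src C g\<close>\<close>

definition hom :: "('o, 'm, 'z) cat_scheme \<Rightarrow> 'o \<Rightarrow> 'o \<Rightarrow> 'm set" where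
  "hom C x y = {f \<in> arr C. src C f = x \<and> tgt C f = y}"

locale category =
  fixes C :: "('o, 'm, 'z) cat_scheme"
  assumes src_obj: "f \<in> arr C \<Longrightarrow> src C f \<in> obj C"
    and tgt_obj: "f \<in> arr C \<Longrightarrow> tgt C f \<in> obj C"
    and idn_hom: "x \<in> obj C \<Longrightarrow> idn C x \<in> hom C x x"
    and cmp_hom: "f \<in> hom C x y \<Longrightarrow> g \<in> hom C y z \<Longrightarrow> cmp C g f \<in> hom C x z"
    and cmp_idn_right: "f \<in> hom C x y \<Longrightarrow> cmp C f (idn C x) = f"
    and cmp_idn_left: "f \<in> hom C x y \<Longrightarrow> cmp C (idn C y) f = f"
    and cmp_assoc: "f \<in> hom C w x \<Longrightarrow> g \<in> hom C x y \<Longrightarrow> h \<in> hom C y z \<Longrightarrow>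
          cmp C h (cmp C g f) = cmp C (cmp C h g) f"

definition isos :: "('o, 'm, 'z) cat_scheme \<Rightarrow> 'o \<Rightarrow> 'o \<Rightarrow> 'm set" where
  "isos C x y = {f \<in> hom C x y. \<exists>g \<in> hom C y x. cmp C g f = idn C x \<and> cmp C f g = idn C y}"

locale groupoid = category +
  assumes all_isos: "x \<in> obj C \<Longrightarrow> y \<in> obj C \<Longrightarrow> hom C x y = isos C x y"

abbreviation Aut :: "('o, 'm, 'z) cat_scheme \<Rightarrow> 'o \<Rightarrow> 'm set" where
  "Aut C x \<equiv> isos C x x"

definition iso_classes :: "('o, 'm, 'z) cat_scheme \<Rightarrow> 'o set set" where
  "iso_classes C = obj C // {(x, y). x \<in> obj C \<and> y \<in> obj C \<and> isos C x y \<noteq> {}}"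

text \<open>The smallness conditions imposed on every groupoid throughout.\<close>

definition small_groupoid :: "('o, 'm, 'z) cat_scheme \<Rightarrow> bool" where
  "small_groupoid C \<longleftrightarrow>
     groupoid C \<and> countable (iso_classes C) \<and> (\<forall>x \<in> obj C. finite (Aut C x))"

definition full_sub :: "('o, 'm, 'z) cat_scheme \<Rightarrow> 'o set \<Rightarrow> ('o, 'm, 'z) cat_scheme" where
  "full_sub C A = C\<lparr>obj := obj C \<inter> A, arr := {f \<in> arr C. src C f \<in> A \<and> tgt C f \<in> A}\<rparr>"

record ('o, 'm, 'p, 'q) functr =
  fobj :: "'o \<Rightarrow> 'p"
  farr :: "'m \<Rightarrow> 'q"

definition is_functor ::
  "('o, 'm, 'y) cat_scheme \<Rightarrow> ('p, 'q, 'z) cat_scheme \<Rightarrow> ('o, 'm, 'p, 'q) functr \<Rightarrow> bool" where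
  "is_functor C D F \<longleftrightarrow>
     (\<forall>x \<in> obj C. fobj F x \<in> obj D) \<and>
     (\<forall>f \<in> arr C. farr F f \<in> hom D (fobj F (src C f)) (fobj F (tgt C f))) \<and>
     (\<forall>x \<in> obj C. farr F (idn C x) = idn D (fobj F x)) \<and>
     (\<forall>f \<in> arr C. \<forall>g \<in> arr C. tgt C f = src C g \<longrightarrow>
        farr F (cmp C g f) = cmp D (farr F g) (farr F f))"

definition id_functor :: "('o, 'm, 'o, 'm) functr" where
  "id_functor = \<lparr>fobj = (\<lambda>x. x), farr = (\<lambda>f. f)\<rparr>"

definition comp_functor ::
  "('p, 'q, 'r, 's) functr \<Rightarrow> ('o, 'm, 'p, 'q) functr \<Rightarrow> ('o, 'm, 'r, 's) functr" where
  "comp_functor G F = \<lparr>fobj = fobj G \<circ> fobj F, farr = farr G \<circ> farr F\<rparr>"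

definition is_nat_iso ::
  "('o, 'm, 'y) cat_scheme \<Rightarrow> ('p, 'q, 'z) cat_scheme \<Rightarrow>
   ('o, 'm, 'p, 'q) functr \<Rightarrow> ('o, 'm, 'p, 'q) functr \<Rightarrow> ('o \<Rightarrow> 'q) \<Rightarrow> bool" where
  "is_nat_iso C D F G \<tau> \<longleftrightarrow>
     (\<forall>x \<in> obj C. \<tau> x \<in> isos D (fobj F x) (fobj G x)) \<and>
     (\<forall>f \<in> arr C. cmp D (\<tau> (tgt C f)) (farr F f) = cmp D (farr G f) (\<tau> (src C f)))"

definition is_cat_equivalence ::
  "('o, 'm, 'y) cat_scheme \<Rightarrow> ('p, 'q, 'z) cat_scheme \<Rightarrow> ('o, 'm, 'p, 'q) functr \<Rightarrow> bool" where
  "is_cat_equivalence C D T \<longleftrightarrow> is_functor C D T \<and>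
     (\<exists>S \<eta> \<epsilon>. is_functor D C S \<and>
        is_nat_iso C C id_functor (comp_functor S T) \<eta> \<and>
        is_nat_iso D D (comp_functor T S) id_functor \<epsilon>)"

text \<open>Groupoid cardinality.  By \<open>SOME\<close> a representative of each isomorphism class is
  chosen; isomorphic objects have equally many automorphisms.\<close>

definition groupoid_card :: "('o, 'm, 'z) cat_scheme \<Rightarrow> ennreal" where
  "groupoid_card C =
     (\<Sum>\<^sub>\<infinity>c \<in> iso_classes C. 1 / of_nat (card (Aut C (SOME x. x \<in> c))))"

definition tame :: "('o, 'm, 'z) cat_scheme \<Rightarrow> bool" where
  "tame C \<longleftrightarrow> groupoid_card C < \<infinity>"


section \<open>Finite sets and bijections\<close>

text \<open>All finite sets are subsets of one infinite type of potential elements, which contains an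
  arbitrary type \<open>'a\<close> of atoms and is closed under tagging, so that disjoint unions
  can be formed inside it.  Since it is infinite, it has subsets of every finite cardinality.\<close>

datatype 'a elt = Atom 'a | InL "'a elt" | InR "'a elt"

text \<open>A map between finite sets is a triple (source, function, target), with the function
  extensional on its source, so that equality of triples is equality of maps.\<close>

type_synonym 'a fmap = "'a elt set \<times> ('a elt \<Rightarrow> 'a elt) \<times> 'a elt set"

definition Fin :: "('a elt set, 'a fmap) cat" where
  "Fin = \<lparr>obj = {A. finite A},
          arr = {(A, f, B). finite A \<and> finite B \<and> f \<in> extensional A \<and> bij_betw f A B},
          src = (\<lambda>(A, f, B). A),
          tgt = (\<lambda>(A, f, B). B),
          idn = (\<lambda>A. (A, restrict (\<lambda>u. u) A, A)),
          cmp = (\<lambda>(B', g, C) (A, f, B). (A, compose A g f, C))\<rparr>"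

definition dunion :: "'a elt set \<Rightarrow> 'a elt set \<Rightarrow> 'a elt set" (infixr \<open>\<squnion>\<^sub>s\<close> 65) where
  "A \<squnion>\<^sub>s B = InL ` A \<union> InR ` B"

fun dunion_fmap :: "'a fmap \<Rightarrow> 'a fmap \<Rightarrow> 'a fmap" where
  "dunion_fmap (A, f, B) (A', f', B') =
     (A \<squnion>\<^sub>s A',
      restrict (\<lambda>w. case w of InL u \<Rightarrow> InL (f u) | InR u \<Rightarrow> InR (f' u) | Atom a \<Rightarrow> undefined) (A \<squnion>\<^sub>s A'),
      B \<squnion>\<^sub>s B')"


section \<open>Stuff types\<close>

record ('o, 'm, 'a) stuff = "('o, 'm) cat" +
  und :: "('o, 'm, 'a elt set, 'a fmap) functr"

definition stuff_type :: "('o, 'm, 'a) stuff \<Rightarrow> bool" where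
  "stuff_type G \<longleftrightarrow> small_groupoid G \<and> is_functor G Fin (und G)"

definition graded :: "('o, 'm, 'a) stuff \<Rightarrow> nat \<Rightarrow> ('o, 'm, 'a) stuff" where
  "graded G n = full_sub G {x. card (fobj (und G) x) = n}"

definition stuff_morphism ::
  "('o, 'm, 'a) stuff \<Rightarrow> ('p, 'q, 'a) stuff \<Rightarrow> ('o, 'm, 'p, 'q) functr \<Rightarrow> ('o \<Rightarrow> 'a fmap) \<Rightarrow> bool"
  where "stuff_morphism G H T \<tau> \<longleftrightarrow>
    is_functor G H T \<and> is_nat_iso G Fin (und G) (comp_functor (und H) T) \<tau>"

definition stuff_equivalence ::
  "('o, 'm, 'a) stuff \<Rightarrow> ('p, 'q, 'a) stuff \<Rightarrow> ('o, 'm, 'p, 'q) functr \<Rightarrow> ('o \<Rightarrow> 'a fmap) \<Rightarrow> bool"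
  where "stuff_equivalence G H T \<tau> \<longleftrightarrow> stuff_morphism G H T \<tau> \<and> is_cat_equivalence G H T"


subsection \<open>Sums and products\<close>

definition stuff_plus ::
  "('o, 'm, 'a) stuff \<Rightarrow> ('p, 'q, 'a) stuff \<Rightarrow> ('o + 'p, 'm + 'q, 'a) stuff" where
  "stuff_plus G H =
     \<lparr>obj = obj G <+> obj H,
      arr = arr G <+> arr H,
      src = map_sum (src G) (src H),
      tgt = map_sum (tgt G) (tgt H),
      idn = map_sum (idn G) (idn H),
      cmp = (\<lambda>g f. case (g, f) of
               (Inl g', Inl f') \<Rightarrow> Inl (cmp G g' f')
             | (Inr g', Inr f') \<Rightarrow> Inr (cmp H g' f')
             | _ \<Rightarrow> undefined),
      und = \<lparr>fobj = case_sum (fobj (und G)) (fobj (und H)),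
             farr = case_sum (farr (und G)) (farr (und H))\<rparr>\<rparr>"

text \<open>The sum of a family of stuff types; for an empty index set it is the empty stuff type.\<close>

definition stuff_sum ::
  "'i set \<Rightarrow> ('i \<Rightarrow> ('o, 'm, 'a) stuff) \<Rightarrow> ('i \<times> 'o, 'i \<times> 'm, 'a) stuff" where
  "stuff_sum I G =
     \<lparr>obj = (SIGMA i:I. obj (G i)),
      arr = (SIGMA i:I. arr (G i)),
      src = (\<lambda>(i, f). (i, src (G i) f)),
      tgt = (\<lambda>(i, f). (i, tgt (G i) f)),
      idn = (\<lambda>(i, x). (i, idn (G i) x)),
      cmp = (\<lambda>(j, g) (i, f). (i, cmp (G i) g f)),
      und = \<lparr>fobj = (\<lambda>(i, x). fobj (und (G i)) x),
             farr = (\<lambda>(i, f). farr (und (G i)) f)\<rparr>\<rparr>"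

definition stuff_times ::
  "('o, 'm, 'a) stuff \<Rightarrow> ('p, 'q, 'a) stuff \<Rightarrow> ('o \<times> 'p, 'm \<times> 'q, 'a) stuff" where
  "stuff_times G H =
     \<lparr>obj = obj G \<times> obj H,
      arr = arr G \<times> arr H,
      src = map_prod (src G) (src H),
      tgt = map_prod (tgt G) (tgt H),
      idn = map_prod (idn G) (idn H),
      cmp = (\<lambda>(g, g') (f, f'). (cmp G g f, cmp H g' f')),
      und = \<lparr>fobj = (\<lambda>(x, y). fobj (und G) x \<squnion>\<^sub>s fobj (und H) y),
             farr = (\<lambda>(f, g). dunion_fmap (farr (und G) f) (farr (und H) g))\<rparr>\<rparr>"

definition stuff_one :: "(unit, unit, 'a) stuff" where
  "stuff_one =
     \<lparr>obj = {()}, arr = {()}, src = (\<lambda>_. ()), tgt = (\<lambda>_. ()), idn = (\<lambda>_. ()), cmp = (\<lambda>_ _. ()),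
      und = \<lparr>fobj = (\<lambda>_. {}), farr = (\<lambda>_. idn Fin {})\<rparr>\<rparr>"

text \<open>The \<open>k\<close>-fold partitional product \<open>G \<cdot> (G \<cdot> (\<dots> \<cdot> \<one>))\<close>, whose objects and
  morphisms are the lists of length \<open>k\<close> of those of \<open>G\<close>.\<close>

definition stuff_power :: "('o, 'm, 'a) stuff \<Rightarrow> nat \<Rightarrow> ('o list, 'm list, 'a) stuff" where
  "stuff_power G k =
     \<lparr>obj = {xs. length xs = k \<and> set xs \<subseteq> obj G},
      arr = {fs. length fs = k \<and> set fs \<subseteq> arr G},
      src = map (src G),
      tgt = map (tgt G),
      idn = map (idn G),
      cmp = map2 (cmp G),
      und = \<lparr>fobj = (\<lambda>xs. foldr (\<lambda>x A. fobj (und G) x \<squnion>\<^sub>s A) xs {}),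
             farr = (\<lambda>fs. foldr (\<lambda>f \<phi>. dunion_fmap (farr (und G) f) \<phi>) fs (idn Fin {}))\<rparr>\<rparr>"


subsection \<open>Totally ordered sets\<close>

type_synonym 'a loset = "'a elt set \<times> ('a elt \<times> 'a elt) set"

definition stuff_Z :: "nat \<Rightarrow> ('a loset, 'a loset \<times> ('a elt \<Rightarrow> 'a elt) \<times> 'a loset, 'a) stuff" where
  "stuff_Z k =
     \<lparr>obj = {(A, r). finite A \<and> card A = k \<and> linear_order_on A r},
      arr = {((A, r), f, (B, s)).
               finite A \<and> card A = k \<and> linear_order_on A r \<and>
               finite B \<and> card B = k \<and> linear_order_on B s \<and>
               f \<in> extensional A \<and> bij_betw f A B \<and> (\<forall>(u, v) \<in> r. (f u, f v) \<in> s)},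
      src = (\<lambda>(X, f, Y). X),
      tgt = (\<lambda>(X, f, Y). Y),
      idn = (\<lambda>(A, r). ((A, r), restrict (\<lambda>u. u) A, (A, r))),
      cmp = (\<lambda>(Y', g, Z) (X, f, Y). (X, compose (fst X) g f, Z)),
      und = \<lparr>fobj = (\<lambda>(A, r). A),
             farr = (\<lambda>(X, f, Y). (fst X, f, fst Y))\<rparr>\<rparr>"

definition stuff_copies :: "nat \<Rightarrow> ('o, 'm, 'a) stuff \<Rightarrow> (nat \<times> 'o, nat \<times> 'm, 'a) stuff" where
  "stuff_copies a G = stuff_sum {..<a} (\<lambda>_. G)"

text \<open>\<open>p(Z) = a\<^sub>0 \<one> + a\<^sub>1 Z + \<dots> + a\<^sub>k Z\<^sup>k\<close>\<close>

definition stuff_poly where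
  "stuff_poly p =
     stuff_plus (stuff_copies (coeff p 0) stuff_one)
                (stuff_sum {1..degree p} (\<lambda>k. stuff_copies (coeff p k) (stuff_Z k)))"


section \<open>Analytic tameness\<close>

definition relatively_tame :: "('o, 'm, 'a) stuff \<Rightarrow> bool" where
  "relatively_tame G \<longleftrightarrow> (\<forall>n. tame (graded G n))"

definition gen_series :: "('o, 'm, 'a) stuff \<Rightarrow> complex fps" where
  "gen_series G = Abs_fps (\<lambda>n. of_real (enn2real (groupoid_card (graded G n))))"

text \<open>Analytic continuation of the germ of \<open>g\<close> at the start of the path \<open>\<gamma>\<close>: a germ
  \<open>f t\<close> of an analytic function at every point \<open>\<gamma> t\<close>, such that for \<open>s\<close> close to \<open>t\<close> the
  functions \<open>f s\<close> and \<open>f t\<close> have the same germ at \<open>\<gamma> s\<close>.\<close>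

definition continuation_along ::
  "(complex \<Rightarrow> complex) \<Rightarrow> (real \<Rightarrow> complex) \<Rightarrow> (real \<Rightarrow> complex \<Rightarrow> complex) \<Rightarrow> bool" where
  "continuation_along g \<gamma> f \<longleftrightarrow> path \<gamma> \<and>
     (\<forall>t \<in> {0..1}. f t analytic_on {\<gamma> t}) \<and>
     (\<forall>\<^sub>F z in nhds (pathstart \<gamma>). f 0 z = g z) \<and>
     (\<forall>t \<in> {0..1}. \<exists>\<delta>>0. \<forall>s \<in> {0..1}. \<bar>s - t\<bar> < \<delta> \<longrightarrow>
        (\<forall>\<^sub>F z in nhds (\<gamma> s). f s z = f t z))"

definition continuation_value :: "(complex \<Rightarrow> complex) \<Rightarrow> complex \<Rightarrow> bool" where
  "continuation_value g v \<longleftrightarrow>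
     (\<exists>\<gamma> f. continuation_along g \<gamma> f \<and> pathstart \<gamma> = 0 \<and> pathfinish \<gamma> = 1 \<and> f 1 1 = v)"

definition analytically_tame :: "('o, 'm, 'a) stuff \<Rightarrow> bool" where
  "analytically_tame G \<longleftrightarrow> relatively_tame G \<and> fps_conv_radius (gen_series G) > 0 \<and>
     (\<exists>!v. continuation_value (eval_fps (gen_series G)) v)"

definition analytic_card :: "('o, 'm, 'a) stuff \<Rightarrow> complex" where
  "analytic_card G = (THE v. continuation_value (eval_fps (gen_series G)) v)"


section \<open>Nested equivalences\<close>

text \<open>\<open>p\<^sub>0(Z) + p\<^sub>1(Z) G + \<dots> + p\<^sub>m(Z) G\<^sup>m\<close>\<close>

definition nested_target where
  "nested_target m p G =
     stuff_plus (stuff_poly (p 0))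
                (stuff_sum {1..m} (\<lambda>i. stuff_times (stuff_poly (p i)) (stuff_power G i)))"

definition nested_equivalence where
  "nested_equivalence G m p T \<tau> \<longleftrightarrow>
     (\<forall>i \<le> m. range (coeff (p i)) \<subseteq> {0, 1}) \<and> p m \<noteq> 0 \<and>
     stuff_equivalence G (nested_target m p G) T \<tau>"

definition structural_poly :: "nat \<Rightarrow> (nat \<Rightarrow> nat poly) \<Rightarrow> int poly" where
  "structural_poly m p = (\<Sum>i\<le>m. monom (int (poly (p i) 1)) i)"

end

theory Submission
  imports Defs "HOL-Complex_Analysis.Complex_Analysis"
begin

text \<open>
  Call \<open>R\<close> a transversal of a groupoid if every object is isomorphic to exactly one member of \<open>R\<close>;
  the groupoid cardinality is the sum of \<open>1 / #Aut r\<close> over \<open>r \<in> R\<close>.  Transversals of sums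
  and products are sums and products of transversals, so generating series turn sums, partitional
  products, powers and \<open>Z\<^sup>k\<close> into sums, products, powers and \<open>z\<^sup>k\<close>, and they are
  invariant under equivalence.  A nested equivalence therefore yields the identity
  \<open>g = p\<^sub>0 + p\<^sub>1 g + \<dots> + p\<^sub>m g\<^sup>m\<close> of generating series.  By the identity theorem this
  identity of germs at \<open>0\<close> persists under continuation along any path, and at \<open>z = 1\<close> it
  is the fixed point equation.
\<close>

section \<open>Transversals\<close>

text \<open>The total cardinality of \<open>G\<close> may be infinite, so counting whole groupoids
  could yield a mere equation between infinities. Counting each degree separately keeps every number
  finite; the resulting equation can then be continued to points where the series diverges. The
  counts are carried by the relation \<open>has_series\<close>: in every degree, the weights of some
  transversal sum to the given real coefficient. Being an existential statement about convergent
  sums, it can be built up along the shape of \<open>nested_target\<close>, so that convergence for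
  the target comes together with its series. The link to \<open>groupoid_card\<close>, with its
  representatives chosen by \<open>SOME\<close>, is made only once, for \<open>G\<close>. An
  equivalence then forces the two series to coincide, whatever transversals were used. The integers
  p_i(1) arise because Z^k has series z^k: hence p_i(Z) has series p_i(z), which is read off at the
  endpoint z = 1 of the path.\<close>

lemma isosI:
  assumes "f \<in> hom C x y" "g \<in> hom C y x" "cmp C g f = idn C x" "cmp C f g = idn C y"
  shows "f \<in> isos C x y"
  using assms by (auto simp: isos_def)

lemma isosE:
  assumes "f \<in> isos C x y"
  obtains g where "f \<in> hom C x y" "g \<in> hom C y x" "cmp C g f = idn C x" "cmp C f g = idn C y"
  using assms by (auto simp: isos_def)

context category
begin

lemma isos_obj: "isos C x y \<noteq> {} \<Longrightarrow> x \<in> obj C \<and> y \<in> obj C"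
  using src_obj tgt_obj by (fastforce simp: isos_def hom_def)

lemma isos_refl: "x \<in> obj C \<Longrightarrow> isos C x x \<noteq> {}"
  using idn_hom cmp_idn_right by (fastforce simp: isos_def)

lemma isos_sym: "isos C x y \<noteq> {} \<Longrightarrow> isos C y x \<noteq> {}"
  by (force simp: isos_def)

lemma cmp_isos:
  assumes "f \<in> isos C x y" "g \<in> isos C y z"
  shows "cmp C g f \<in> isos C x z"
proof -
  obtain f' g' where f: "f \<in> hom C x y" "f' \<in> hom C y x" "cmp C f' f = idn C x" "cmp C f f' = idn C y"
    and g: "g \<in> hom C y z" "g' \<in> hom C z y" "cmp C g' g = idn C y" "cmp C g g' = idn C z"
    using assms by (blast elim!: isosE)
  note gf = cmp_hom[OF f(1) g(1)] cmp_hom[OF g(2) f(2)]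
  have "cmp C (cmp C f' g') (cmp C g f) = cmp C f' (cmp C g' (cmp C g f))"
    using cmp_assoc[OF gf(1) g(2) f(2)] by simp
  also have "\<dots> = cmp C f' f"
    using cmp_assoc[OF f(1) g(1) g(2)] g(3) cmp_idn_left[OF f(1)] by simp
  finally have 1: "cmp C (cmp C f' g') (cmp C g f) = idn C x" using f(3) by simp
  have "cmp C (cmp C g f) (cmp C f' g') = cmp C g (cmp C f (cmp C f' g'))"
    using cmp_assoc[OF gf(2) f(1) g(1)] by simp
  also have "\<dots> = cmp C g g'"
    using cmp_assoc[OF g(2) f(2) f(1)] f(4) cmp_idn_left[OF g(2)] by simp
  finally have 2: "cmp C (cmp C g f) (cmp C f' g') = idn C z" using g(4) by simp
  show ?thesis by (rule isosI[OF gf 1 2])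
qed

lemma isos_trans: "isos C x y \<noteq> {} \<Longrightarrow> isos C y z \<noteq> {} \<Longrightarrow> isos C x z \<noteq> {}"
  using cmp_isos by blast

lemma iso_cancel_right:
  assumes e: "e \<in> isos C x y" and f: "f \<in> hom C y z" and g: "g \<in> hom C y z"
    and eq: "cmp C f e = cmp C g e"
  shows "f = g"
proof -
  obtain e' where e': "e' \<in> hom C y x" "cmp C e e' = idn C y" "e \<in> hom C x y"
    using e by (blast elim!: isosE)
  have "cmp C (cmp C f e) e' = f" "cmp C (cmp C g e) e' = g"
    by (simp_all add: cmp_assoc[OF e'(1,3) f, symmetric] cmp_assoc[OF e'(1,3) g, symmetric] e'(2)
        cmp_idn_right[OF f] cmp_idn_right[OF g])
  then show ?thesis
    using eq by metis
qed

lemma iso_cancel_left: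
  assumes e: "e \<in> isos C y z" and f: "f \<in> hom C x y" and g: "g \<in> hom C x y"
    and eq: "cmp C e f = cmp C e g"
  shows "f = g"
proof -
  obtain e' where e': "e' \<in> hom C z y" "cmp C e' e = idn C y" "e \<in> hom C y z"
    using e by (blast elim!: isosE)
  have "cmp C e' (cmp C e f) = f" "cmp C e' (cmp C e g) = g"
    by (simp_all add: cmp_assoc[OF f e'(3,1)] cmp_assoc[OF g e'(3,1)] e'(2)
        cmp_idn_left[OF f] cmp_idn_left[OF g])
  then show ?thesis
    using eq by metis
qed

text \<open>Conjugation with an isomorphism \<open>e\<close> from \<open>x\<close> to
  \<open>y\<close> turns automorphisms of one object into automorphisms of the other.\<close>

lemma bij_betw_Aut:
  assumes "isos C x y \<noteq> {}"
  shows "\<exists>h. bij_betw h (Aut C x) (Aut C y)"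
proof -
  obtain e e' where e: "e \<in> isos C x y" "e' \<in> isos C y x" "cmp C e' e = idn C x" "cmp C e e' = idn C y"
    using assms by (force simp: isos_def)
  have e_hom: "e \<in> hom C x y" "e' \<in> hom C y x"
    using e by (auto simp: isos_def)
  have Aut_hom: "f \<in> Aut C z \<Longrightarrow> f \<in> hom C z z" for f z
    by (simp add: isos_def)
  \<comment> \<open>Stated for any \<open>a\<close> with left inverse \<open>b\<close>, so that it
    shows both that conjugating with \<open>e\<close> and then \<open>e'\<close> is the identity
    and, with the roles exchanged, the converse.\<close>
  have inv: "cmp C b (cmp C (cmp C a (cmp C f b)) a) = f"
    if a: "a \<in> hom C v w" "b \<in> hom C w v" "cmp C b a = idn C v" and f: "f \<in> hom C v v" for a b f v w
  proof -
    have fb: "cmp C f b \<in> hom C w v" and fba: "cmp C (cmp C f b) a \<in> hom C v v"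
      using a f by (blast intro: cmp_hom)+
    have "cmp C b (cmp C (cmp C a (cmp C f b)) a) = cmp C b (cmp C a (cmp C (cmp C f b) a))"
      by (simp add: cmp_assoc[OF a(1) fb a(1)])
    also have "\<dots> = cmp C (cmp C f b) a"
      by (simp add: cmp_assoc[OF fba a(1) a(2)] cmp_idn_left[OF fba] a(3))
    also have "\<dots> = f"
      by (simp add: cmp_assoc[OF a(1) a(2) f, symmetric] cmp_idn_right[OF f] a(3))
    finally show ?thesis .
  qed
  show ?thesis
  proof (rule exI[of _ "\<lambda>f. cmp C e (cmp C f e')"],
      rule bij_betw_byWitness[where f' = "\<lambda>f. cmp C e' (cmp C f e)"])
    show "\<forall>f\<in>Aut C x. cmp C e' (cmp C (cmp C e (cmp C f e')) e) = f"
      using inv[OF e_hom e(3)] Aut_hom by blast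
    show "\<forall>f\<in>Aut C y. cmp C e (cmp C (cmp C e' (cmp C f e)) e') = f"
      using inv[OF e_hom(2,1) e(4)] Aut_hom by blast
    show "(\<lambda>f. cmp C e (cmp C f e')) ` Aut C x \<subseteq> Aut C y"
      using e cmp_isos by blast
    show "(\<lambda>f. cmp C e' (cmp C f e)) ` Aut C y \<subseteq> Aut C x"
      using e cmp_isos by blast
  qed
qed

lemma card_Aut_eq: "isos C x y \<noteq> {} \<Longrightarrow> card (Aut C x) = card (Aut C y)"
  using bij_betw_Aut bij_betw_same_card by metis

lemma equiv_isos: "equiv (obj C) {(x, y). x \<in> obj C \<and> y \<in> obj C \<and> isos C x y \<noteq> {}}"
proof (rule equivI)
  show "sym {(x, y). x \<in> obj C \<and> y \<in> obj C \<and> isos C x y \<noteq> {}}"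
    using isos_sym unfolding sym_def by blast
  show "trans {(x, y). x \<in> obj C \<and> y \<in> obj C \<and> isos C x y \<noteq> {}}"
    using isos_trans unfolding trans_def by blast
  show "refl_on (obj C) {(x, y). x \<in> obj C \<and> y \<in> obj C \<and> isos C x y \<noteq> {}}"
    using isos_refl unfolding refl_on_def by blast
qed blast

end

definition transversal :: "('o, 'm, 'z) cat_scheme \<Rightarrow> 'o set \<Rightarrow> bool" where
  "transversal C R \<longleftrightarrow> R \<subseteq> obj C \<and> (\<forall>x \<in> obj C. \<exists>!r. r \<in> R \<and> isos C x r \<noteq> {})"

lemma transversalD:
  assumes "transversal C R"
  shows "r \<in> R \<Longrightarrow> r \<in> obj C" and "x \<in> obj C \<Longrightarrow> \<exists>r\<in>R. isos C x r \<noteq> {}"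
    and "x \<in> obj C \<Longrightarrow> r \<in> R \<Longrightarrow> r' \<in> R \<Longrightarrow> isos C x r \<noteq> {} \<Longrightarrow> isos C x r' \<noteq> {} \<Longrightarrow> r = r'"
  using assms unfolding transversal_def by blast+

lemma transversalI:
  assumes "\<And>r. r \<in> R \<Longrightarrow> r \<in> obj C" and "\<And>x. x \<in> obj C \<Longrightarrow> \<exists>r\<in>R. isos C x r \<noteq> {}"
    and "\<And>x r r'. x \<in> obj C \<Longrightarrow> r \<in> R \<Longrightarrow> r' \<in> R \<Longrightarrow> isos C x r \<noteq> {} \<Longrightarrow> isos C x r' \<noteq> {} \<Longrightarrow> r = r'"
  shows "transversal C R"
  unfolding transversal_def using assms by blast

context category
begin

abbreviation isorel where
  "isorel \<equiv> {(x, y). x \<in> obj C \<and> y \<in> obj C \<and> isos C x y \<noteq> {}}"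

lemma ex_transversal: "\<exists>R. transversal C R"
proof -
  \<comment> \<open>The choice is made from the isomorphism class as a set, so isomorphic objects,
    having the same class, receive the same representative.\<close>
  define rep where "rep x = (SOME y. y \<in> isorel `` {x})" for x
  have rep: "isos C x (rep x) \<noteq> {} \<and> rep x \<in> obj C" if "x \<in> obj C" for x
  proof -
    have "x \<in> isorel `` {x}"
      using that isos_refl by auto
    then have "rep x \<in> isorel `` {x}"
      unfolding rep_def by (rule someI)
    then show ?thesis by auto
  qed
  have rep_eq: "rep x = rep y" if "isos C x y \<noteq> {}" for x y
  proof -
    have "isorel `` {x} = isorel `` {y}"
      by (rule equiv_class_eq[OF equiv_isos]) (use that isos_obj in auto)
    then show ?thesis by (simp add: rep_def)
  qed
  have "transversal C (rep ` obj C)"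
  proof (rule transversalI)
    fix x r r' assume x: "x \<in> obj C" "r \<in> rep ` obj C" "r' \<in> rep ` obj C" "isos C x r \<noteq> {}" "isos C x r' \<noteq> {}"
    then obtain y y' where y: "r = rep y" "y \<in> obj C" "r' = rep y'" "y' \<in> obj C" by auto
    then have "isos C x y \<noteq> {}" "isos C x y' \<noteq> {}"
      using x rep isos_trans isos_sym by metis+
    then show "r = r'" using y rep_eq by metis
  qed (use rep in blast)+
  then show ?thesis by blast
qed

text \<open>Sending a member of \<open>R\<close> to its class is a bijection onto
  \<open>iso_classes C\<close>. The representative picked by \<open>SOME\<close> is isomorphic to
  that member, hence has as many automorphisms.\<close>

lemma groupoid_card_transversal:
  assumes "transversal C R"
  shows "groupoid_card C = (\<Sum>\<^sub>\<infinity>r\<in>R. 1 / of_nat (card (Aut C r)))"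
proof -
  note R = transversalD[OF assms]
  have bij: "bij_betw (\<lambda>r. isorel `` {r}) R (iso_classes C)"
  proof (rule bij_betwI')
    fix r s assume rs: "r \<in> R" "s \<in> R"
    show "(isorel `` {r} = isorel `` {s}) = (r = s)"
    proof
      assume "isorel `` {r} = isorel `` {s}"
      then have "(r, s) \<in> isorel"
        by (rule eq_equiv_class[OF _ equiv_isos]) (rule R(1)[OF rs(2)])
      then have "isos C r s \<noteq> {}" by blast
      then show "r = s"
        using R(3)[OF R(1)[OF rs(1)] rs isos_refl[OF R(1)[OF rs(1)]]] by blast
    qed simp
  next
    fix r assume "r \<in> R"
    then show "isorel `` {r} \<in> iso_classes C"
      unfolding iso_classes_def using R(1) by (blast intro: quotientI)
  next
    fix c assume "c \<in> iso_classes C"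
    then obtain x where x: "x \<in> obj C" "c = isorel `` {x}"
      unfolding iso_classes_def by (blast elim: quotientE)
    then obtain r where r: "r \<in> R" "isos C x r \<noteq> {}" using R by blast
    then have "c = isorel `` {r}"
      unfolding x(2) by (intro equiv_class_eq[OF equiv_isos]) (use x R(1) in blast)
    then show "\<exists>r\<in>R. c = isorel `` {r}" using r by blast
  qed
  have "card (Aut C (SOME x. x \<in> isorel `` {r})) = card (Aut C r)" if "r \<in> R" for r
  proof -
    have "r \<in> isorel `` {r}"
      using R(1)[OF that] isos_refl by blast
    then have "(SOME x. x \<in> isorel `` {r}) \<in> isorel `` {r}" by (rule someI)
    then have "isos C r (SOME x. x \<in> isorel `` {r}) \<noteq> {}" by blast
    then show ?thesis by (rule card_Aut_eq[symmetric])
  qed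
  then show ?thesis
    unfolding groupoid_card_def
    by (subst infsum_reindex_bij_betw[OF bij, symmetric]) (rule infsum_cong, simp only:)
qed

end

lemma functor_isos:
  assumes "is_functor C D F" "category C" "f \<in> isos C x y"
  shows "farr F f \<in> isos D (fobj F x) (fobj F y)"
proof -
  obtain g where g: "f \<in> hom C x y" "g \<in> hom C y x" "cmp C g f = idn C x" "cmp C f g = idn C y"
    using assms(3) by (blast elim: isosE)
  then have [simp]: "x \<in> obj C" "y \<in> obj C"
    using category.isos_obj[OF assms(2)] assms(3) by blast+
  have F: "farr F h \<in> hom D (fobj F u) (fobj F v)" if "h \<in> hom C u v" for h u v
    using that assms(1) unfolding is_functor_def hom_def by blast
  have F_cmp: "farr F (cmp C k h) = cmp D (farr F k) (farr F h)" if "h \<in> hom C u v" "k \<in> hom C v w" for h k u v w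
    using that assms(1) by (simp add: is_functor_def hom_def)
  have F_idn: "farr F (idn C u) = idn D (fobj F u)" if "u \<in> obj C" for u
    using that assms(1) by (simp add: is_functor_def)
  show ?thesis
    using F[OF g(1)] F[OF g(2)] F_cmp[OF g(1,2)] F_cmp[OF g(2,1)] g(3,4) F_idn
    by (intro isosI[where g = "farr F g"]) simp_all
qed

lemma functor_isos_nonempty:
  assumes "is_functor C D F" "category C" "isos C x y \<noteq> {}"
  shows "isos D (fobj F x) (fobj F y) \<noteq> {}"
  using functor_isos[OF assms(1,2)] assms(3) by blast

section \<open>Generating series of stuff types\<close>

text \<open>What counting sees of a stuff type: the action of \<open>und\<close> on morphisms enters
  only through its consequence that isomorphic objects have underlying sets of equal size. Each
  operation on stuff types then only has to preserve these numerical facts.\<close>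

definition graded_category :: "('o, 'm, 'a) stuff \<Rightarrow> bool" where
  "graded_category G \<longleftrightarrow> category G \<and>
     (\<forall>x \<in> obj G. finite (Aut G x) \<and> finite (fobj (und G) x)) \<and>
     (\<forall>x y. isos G x y \<noteq> {} \<longrightarrow> card (fobj (und G) x) = card (fobj (und G) y))"

text \<open>\<open>has_sum\<close> in the reals records convergence together with the value. The
  transversal is existential, so every construction can supply the one that suits it.\<close>

definition has_series :: "('o, 'm, 'a) stuff \<Rightarrow> real fps \<Rightarrow> bool" where
  "has_series G a \<longleftrightarrow> graded_category G \<and>
     (\<exists>R. transversal G R \<and>
       (\<forall>n. ((\<lambda>x. 1 / real (card (Aut G x))) has_sum fps_nth a n) {x \<in> R. card (fobj (und G) x) = n}))"

lemma stuff_type_graded_category: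
  assumes "stuff_type G"
  shows "graded_category G"
proof -
  have G: "category G" "\<forall>x \<in> obj G. finite (Aut G x)" "is_functor G Fin (und G)"
    using assms by (auto simp: stuff_type_def small_groupoid_def groupoid_def)
  have "card (fobj (und G) x) = card (fobj (und G) y)" if "isos G x y \<noteq> {}" for x y
  proof -
    have "isos Fin (fobj (und G) x) (fobj (und G) y) \<noteq> {}"
      by (rule functor_isos_nonempty[OF G(3,1) that])
    then show ?thesis
      by (auto simp: isos_def hom_def Fin_def dest: bij_betw_same_card)
  qed
  then show ?thesis
    using G by (auto simp: graded_category_def is_functor_def Fin_def)
qed

section \<open>Graded components and their cardinalities\<close>

lemma isos_full_sub:
  "x \<in> A \<Longrightarrow> y \<in> A \<Longrightarrow> isos (full_sub C A) x y = isos C x y"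
  by (auto simp: isos_def hom_def full_sub_def)

lemma hom_full_sub: "f \<in> hom (full_sub C A) x y \<longleftrightarrow> f \<in> hom C x y \<and> x \<in> A \<and> y \<in> A"
  by (auto simp: hom_def full_sub_def)

lemma full_sub_simps [simp]:
  "obj (full_sub C A) = obj C \<inter> A" "src (full_sub C A) = src C" "tgt (full_sub C A) = tgt C"
  "idn (full_sub C A) = idn C" "cmp (full_sub C A) = cmp C"
  by (simp_all add: full_sub_def)

lemma category_full_sub:
  assumes "category C"
  shows "category (full_sub C A)"
proof -
  interpret category C by fact
  show ?thesis
  proof
    show "src (full_sub C A) f \<in> obj (full_sub C A)" "tgt (full_sub C A) f \<in> obj (full_sub C A)"
      if "f \<in> arr (full_sub C A)" for f
      using that src_obj tgt_obj by (auto simp: full_sub_def)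
  qed (auto simp: hom_full_sub intro: idn_hom cmp_hom cmp_idn_left cmp_idn_right cmp_assoc)
qed

text \<open>Isomorphic objects have the same degree, so every isomorphism class lies inside a single
  graded component.\<close>

lemma transversal_graded:
  assumes "graded_category G" "transversal G R"
  shows "transversal (graded G n) {x \<in> R. card (fobj (und G) x) = n}"
proof (rule transversalI)
  note R = transversalD[OF assms(2)]
  have obj: "x \<in> obj (graded G n) \<longleftrightarrow> x \<in> obj G \<and> card (fobj (und G) x) = n" for x
    by (auto simp: graded_def full_sub_def)
  have isos: "isos (graded G n) x y = isos G x y"
    if "card (fobj (und G) x) = n" "card (fobj (und G) y) = n" for x y
    using that by (simp add: graded_def isos_full_sub)
  show "r \<in> obj (graded G n)" if "r \<in> {x \<in> R. card (fobj (und G) x) = n}" for r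
    using that R(1) obj by blast
  show "\<exists>r\<in>{x \<in> R. card (fobj (und G) x) = n}. isos (graded G n) x r \<noteq> {}"
    if "x \<in> obj (graded G n)" for x
  proof -
    obtain r where r: "r \<in> R" "isos G x r \<noteq> {}"
      using R(2) \<open>x \<in> obj (graded G n)\<close> obj by blast
    then have "card (fobj (und G) r) = n"
      using assms(1) that unfolding graded_category_def obj by metis
    then show ?thesis
      using r that isos[of x r] unfolding obj by blast
  qed
  show "r = s" if "x \<in> obj (graded G n)" "r \<in> {x \<in> R. card (fobj (und G) x) = n}"
    "s \<in> {x \<in> R. card (fobj (und G) x) = n}" "isos (graded G n) x r \<noteq> {}" "isos (graded G n) x s \<noteq> {}"
    for x r s
    using R(3)[of x r s] that obj isos by auto
qed

text \<open>The finite partial sums are bounded by the finite extended sum, so the real family is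
  summable; both infinite sums are the supremum of the same partial sums.\<close>

lemma has_sum_ennreal_infsum:
  fixes f :: "'b \<Rightarrow> real"
  assumes nonneg: "\<And>x. x \<in> A \<Longrightarrow> f x \<ge> 0" and fin: "(\<Sum>\<^sub>\<infinity>x\<in>A. ennreal (f x)) < \<infinity>"
  shows "(f has_sum enn2real (\<Sum>\<^sub>\<infinity>x\<in>A. ennreal (f x))) A"
proof -
  define s where "s = (\<Sum>\<^sub>\<infinity>x\<in>A. ennreal (f x))"
  have sum_le: "sum f F \<le> enn2real s" if "F \<subseteq> A" "finite F" for F
  proof -
    have "ennreal (sum f F) = (\<Sum>x\<in>F. ennreal (f x))"
      using that nonneg by (subst sum_ennreal) auto
    also have "\<dots> = (\<Sum>\<^sub>\<infinity>x\<in>F. ennreal (f x))"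
      using that by simp
    also have "\<dots> \<le> s"
      unfolding s_def using that by (intro infsum_mono_neutral nonneg_summable_on_complete) auto
    finally show ?thesis
      using fin by (metis enn2real_ennreal enn2real_mono infinity_ennreal_def nonneg s_def subsetD sum_nonneg that(1))
  qed
  have "f summable_on A"
    by (rule nonneg_bdd_above_summable_on[OF nonneg]) (auto intro!: bdd_aboveI2[OF sum_le])
  then have "ennreal (infsum f A) = s"
    unfolding s_def using infsum_nonneg_is_SUPREMUM_ennreal[of f A] nonneg
    by (subst nonneg_infsum_complete) (auto intro!: SUP_cong simp: sum_ennreal subset_iff)
  then have "enn2real s = infsum f A"
    using infsum_nonneg[of A f] nonneg by (metis enn2real_ennreal)
  then show ?thesis
    using \<open>f summable_on A\<close> unfolding s_def by (metis has_sum_infsum)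
qed

lemma stuff_type_has_series:
  assumes "stuff_type G" "relatively_tame G"
  shows "has_series G (Abs_fps (\<lambda>n. enn2real (groupoid_card (graded G n))))"
proof -
  have G: "graded_category G"
    by (rule stuff_type_graded_category) fact
  then have cat: "category G" by (simp add: graded_category_def)
  then obtain R where R: "transversal G R"
    using category.ex_transversal by blast
  have "((\<lambda>x. 1 / real (card (Aut G x))) has_sum enn2real (groupoid_card (graded G n)))
      {x \<in> R. card (fobj (und G) x) = n}" (is "(?w has_sum _) ?R") for n
  proof -
    have cat': "category (graded G n)"
      unfolding graded_def by (rule category_full_sub) fact
    have "groupoid_card (graded G n) = (\<Sum>\<^sub>\<infinity>x\<in>?R. 1 / of_nat (card (Aut (graded G n) x)))"
      by (rule category.groupoid_card_transversal[OF cat' transversal_graded[OF G R]])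
    also have "\<dots> = (\<Sum>\<^sub>\<infinity>x\<in>?R. ennreal (?w x))"
    proof (rule infsum_cong)
      fix x assume x: "x \<in> ?R"
      then have x_obj: "x \<in> obj G" using transversalD(1)[OF R] by blast
      \<comment> \<open>Division by zero differs on the two sides: \<open>1 / 0\<close> is infinite
        in \<open>ennreal\<close> but 0 in the reals. The identity together with finiteness of
        \<open>Aut G x\<close> excludes this case.\<close>
      then have "card (Aut G x) \<noteq> 0"
        using G category.isos_refl[OF cat x_obj] by (simp add: graded_category_def)
      moreover have "Aut (graded G n) x = Aut G x"
        using x by (simp add: graded_def isos_full_sub)
      ultimately show "1 / of_nat (card (Aut (graded G n) x)) = ennreal (?w x)"
        by (simp add: divide_ennreal[symmetric] ennreal_of_nat_eq_real_of_nat)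
    qed
    finally have eq: "groupoid_card (graded G n) = (\<Sum>\<^sub>\<infinity>x\<in>?R. ennreal (?w x))" .
    show ?thesis
      unfolding eq
      by (rule has_sum_ennreal_infsum) (use assms(2) in \<open>simp_all add: relatively_tame_def tame_def flip: eq\<close>)
  qed
  then show ?thesis
    using G R by (auto simp: has_series_def)
qed

section \<open>Invariance under equivalence\<close>

lemma cat_equivalence_transversal:
  assumes eq: "is_cat_equivalence C D T" and C: "category C" and D: "category D"
    and fin: "\<And>x. x \<in> obj C \<Longrightarrow> finite (Aut C x)" "\<And>y. y \<in> obj D \<Longrightarrow> finite (Aut D y)"
    and R: "transversal C R" and S: "transversal D S"
  obtains h where "bij_betw h R S" "\<And>r. r \<in> R \<Longrightarrow> isos D (fobj T r) (h r) \<noteq> {}"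
    "\<And>r. r \<in> R \<Longrightarrow> card (Aut D (h r)) = card (Aut C r)"
proof -
  interpret C: category C by fact
  interpret D: category D by fact
  note R = transversalD[OF R] and S = transversalD[OF S]
  obtain U \<eta> \<epsilon> where T: "is_functor C D T" and U: "is_functor D C U"
    and \<eta>: "is_nat_iso C C id_functor (comp_functor U T) \<eta>"
    and \<epsilon>: "is_nat_iso D D (comp_functor T U) id_functor \<epsilon>"
    using eq unfolding is_cat_equivalence_def by blast
  have T_obj: "fobj T x \<in> obj D" if "x \<in> obj C" for x
    using T that by (simp add: is_functor_def)
  have U_obj: "fobj U y \<in> obj C" if "y \<in> obj D" for y
    using U that by (simp add: is_functor_def)
  have \<eta>_iso: "\<eta> x \<in> isos C x (fobj U (fobj T x))" if "x \<in> obj C" for x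
    using \<eta> that by (simp add: is_nat_iso_def id_functor_def comp_functor_def)
  have \<epsilon>_iso: "\<epsilon> y \<in> isos D (fobj T (fobj U y)) y" if "y \<in> obj D" for y
    using \<epsilon> that by (simp add: is_nat_iso_def id_functor_def comp_functor_def)
  have \<eta>_nat: "cmp C (\<eta> x) f = cmp C (farr U (farr T f)) (\<eta> x)" if "f \<in> hom C x x" for f x
    using \<eta> that by (auto simp: is_nat_iso_def id_functor_def comp_functor_def hom_def)
  have \<epsilon>_nat: "cmp D (\<epsilon> y) (farr T (farr U f)) = cmp D f (\<epsilon> y)" if "f \<in> hom D y y" for f y
    using \<epsilon> that by (auto simp: is_nat_iso_def id_functor_def comp_functor_def hom_def)
  have card_T: "card (Aut C x) = card (Aut D (fobj T x))" if x: "x \<in> obj C" for x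
  proof (rule antisym)
    have "inj_on (farr T) (Aut C x)"
    proof (rule inj_onI)
      fix f g assume "f \<in> Aut C x" "g \<in> Aut C x" and eq: "farr T f = farr T g"
      then have fg: "f \<in> hom C x x" "g \<in> hom C x x" by (auto simp: isos_def)
      show "f = g"
        by (rule C.iso_cancel_left[OF \<eta>_iso[OF x] fg]) (simp only: \<eta>_nat[OF fg(1)] \<eta>_nat[OF fg(2)] eq)
    qed
    then show "card (Aut C x) \<le> card (Aut D (fobj T x))"
      by (rule card_inj_on_le) (use functor_isos[OF T C] fin(2) T_obj x in blast)+
    have y: "fobj T x \<in> obj D" by (rule T_obj) fact
    have "inj_on (farr U) (Aut D (fobj T x))"
    proof (rule inj_onI)
      fix f g assume "f \<in> Aut D (fobj T x)" "g \<in> Aut D (fobj T x)" and eq: "farr U f = farr U g"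
      then have fg: "f \<in> hom D (fobj T x) (fobj T x)" "g \<in> hom D (fobj T x) (fobj T x)"
        by (auto simp: isos_def)
      show "f = g"
        by (rule D.iso_cancel_right[OF \<epsilon>_iso[OF y] fg])
          (simp only: \<epsilon>_nat[OF fg(1), symmetric] \<epsilon>_nat[OF fg(2), symmetric] eq)
    qed
    then have "card (Aut D (fobj T x)) \<le> card (Aut C (fobj U (fobj T x)))"
      by (rule card_inj_on_le) (use functor_isos[OF U D] fin(1) U_obj y in blast)+
    also have "\<dots> = card (Aut C x)"
      by (rule C.card_Aut_eq[symmetric]) (use \<eta>_iso[OF x] in blast)
    finally show "card (Aut D (fobj T x)) \<le> card (Aut C x)" .
  qed
  define h where "h r = (SOME s. s \<in> S \<and> isos D (fobj T r) s \<noteq> {})" for r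
  have h: "h r \<in> S" "isos D (fobj T r) (h r) \<noteq> {}" if "r \<in> R" for r
    using someI_ex[of "\<lambda>s. s \<in> S \<and> isos D (fobj T r) s \<noteq> {}"] S(2)[OF T_obj[OF R(1)[OF that]]]
    unfolding h_def by blast+
  \<comment> \<open>Injectivity: an isomorphism between the images of \<open>r\<close> and
    \<open>r'\<close> under \<open>T\<close> is carried back to \<open>r\<close> and
    \<open>r'\<close> by \<open>U\<close> and \<eta>. Surjectivity: \<epsilon> makes
    \<open>s\<close> isomorphic to the image of \<open>fobj U s\<close> under \<open>T\<close>, so
    the member of \<open>R\<close> isomorphic to \<open>fobj U s\<close> is sent to
    \<open>s\<close>.\<close>
  have "bij_betw h R S"
  proof (rule bij_betwI')
    fix r r' assume r: "r \<in> R" "r' \<in> R"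
    show "(h r = h r') = (r = r')"
    proof
      assume "h r = h r'"
      then have "isos D (fobj T r) (fobj T r') \<noteq> {}"
        using D.isos_trans[OF h(2)[OF r(1)]] D.isos_sym[OF h(2)[OF r(2)]] by simp
      then have "isos C (fobj U (fobj T r)) (fobj U (fobj T r')) \<noteq> {}"
        by (rule functor_isos_nonempty[OF U D])
      moreover have "isos C r (fobj U (fobj T r)) \<noteq> {}" "isos C r' (fobj U (fobj T r')) \<noteq> {}"
        using \<eta>_iso[OF R(1)] r by blast+
      ultimately have "isos C r r' \<noteq> {}"
        using C.isos_trans C.isos_sym by meson
      then show "r = r'"
        using R(3)[OF R(1)[OF r(1)] r C.isos_refl[OF R(1)[OF r(1)]]] by blast
    qed simp
  next
    fix s assume s: "s \<in> S"
    have s_obj: "s \<in> obj D" by (rule S(1)) fact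
    obtain r where r: "r \<in> R" "isos C (fobj U s) r \<noteq> {}"
      using R(2)[OF U_obj[OF s_obj]] by blast
    have "isos D s (fobj T (fobj U s)) \<noteq> {}"
      using D.isos_sym \<epsilon>_iso[OF s_obj] by blast
    moreover have "isos D (fobj T (fobj U s)) (fobj T r) \<noteq> {}"
      by (rule functor_isos_nonempty[OF T C]) fact
    ultimately have "isos D s (h r) \<noteq> {}"
      using D.isos_trans h(2)[OF r(1)] by meson
    then have "s = h r"
      using S(3)[OF s_obj s h(1)[OF r(1)] D.isos_refl[OF s_obj]] by blast
    then show "\<exists>r\<in>R. s = h r" using r by blast
  qed (use h in blast)
  then show ?thesis
    using that h(2) card_T R(1) D.card_Aut_eq by metis
qed

text \<open>The equivalence matches the two transversals with equal automorphism counts. The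
  components of \<tau> are bijections of underlying sets, so degrees match as well, and in each
  degree both coefficients are sums of the same weights.\<close>

lemma has_series_unique:
  assumes eq: "stuff_equivalence G H T \<tau>" and G: "has_series G a" and H: "has_series H b"
  shows "a = b"
proof -
  have gG: "graded_category G" and gH: "graded_category H"
    using G H by (simp_all add: has_series_def)
  have T: "is_functor G H T" "is_cat_equivalence G H T"
    "is_nat_iso G Fin (und G) (comp_functor (und H) T) \<tau>"
    using eq by (simp_all add: stuff_equivalence_def stuff_morphism_def)
  have card_T: "card (fobj (und H) (fobj T x)) = card (fobj (und G) x)" if "x \<in> obj G" for x
  proof -
    have "\<tau> x \<in> isos Fin (fobj (und G) x) (fobj (und H) (fobj T x))"
      using T(3) that by (simp add: is_nat_iso_def comp_functor_def)
    then show ?thesis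
      by (auto simp: isos_def hom_def Fin_def dest: bij_betw_same_card)
  qed
  obtain R where R: "transversal G R"
    and a: "\<And>n. ((\<lambda>x. 1 / real (card (Aut G x))) has_sum fps_nth a n) {x \<in> R. card (fobj (und G) x) = n}"
    using G by (auto simp: has_series_def)
  obtain S where S: "transversal H S"
    and b: "\<And>n. ((\<lambda>x. 1 / real (card (Aut H x))) has_sum fps_nth b n) {x \<in> S. card (fobj (und H) x) = n}"
    using H by (auto simp: has_series_def)
  have cats: "category G" "category H"
    and fin: "\<And>x. x \<in> obj G \<Longrightarrow> finite (Aut G x)" "\<And>y. y \<in> obj H \<Longrightarrow> finite (Aut H y)"
    using gG gH by (simp_all add: graded_category_def)
  obtain h where h: "bij_betw h R S" and iso: "\<And>r. r \<in> R \<Longrightarrow> isos H (fobj T r) (h r) \<noteq> {}"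
    and card_h: "\<And>r. r \<in> R \<Longrightarrow> card (Aut H (h r)) = card (Aut G r)"
    using cat_equivalence_transversal[OF T(2) cats fin R S] by metis
  have "card (fobj (und H) (h r)) = card (fobj (und G) r)" if "r \<in> R" for r
    using gH iso[OF that] card_T[OF transversalD(1)[OF R that]] by (simp add: graded_category_def)
  then have bij: "bij_betw h {x \<in> R. card (fobj (und G) x) = n} {x \<in> S. card (fobj (und H) x) = n}" for n
    using h unfolding bij_betw_def by (force intro: inj_on_subset)
  show ?thesis
  proof (rule fps_ext)
    fix n
    have "((\<lambda>x. 1 / real (card (Aut G x))) has_sum fps_nth b n) {x \<in> R. card (fobj (und G) x) = n}"
      using b[of n] unfolding has_sum_reindex_bij_betw[OF bij, symmetric]
      by (rule has_sum_cong[THEN iffD1, rotated]) (simp add: card_h)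
    then show "fps_nth a n = fps_nth b n"
      using a has_sum_unique by blast
  qed
qed

section \<open>Sums and products\<close>

lemma hom_plus:
  "hom (stuff_plus G H) (Inl x) (Inl y) = Inl ` hom G x y"
  "hom (stuff_plus G H) (Inr u) (Inr v) = Inr ` hom H u v"
  "hom (stuff_plus G H) (Inl x) (Inr v) = {}"
  "hom (stuff_plus G H) (Inr u) (Inl y) = {}"
  by (auto simp: hom_def stuff_plus_def)

lemma isos_plus:
  "isos (stuff_plus G H) (Inl x) (Inl y) = Inl ` isos G x y"
  "isos (stuff_plus G H) (Inr u) (Inr v) = Inr ` isos H u v"
  "isos (stuff_plus G H) (Inl x) (Inr v) = {}"
  "isos (stuff_plus G H) (Inr u) (Inl y) = {}"
  by (auto simp: isos_def hom_plus) (auto simp: stuff_plus_def)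

lemma stuff_plus_simps [simp]:
  "obj (stuff_plus G H) = obj G <+> obj H"
  "fobj (und (stuff_plus G H)) (Inl x) = fobj (und G) x"
  "fobj (und (stuff_plus G H)) (Inr y) = fobj (und H) y"
  by (simp_all add: stuff_plus_def)

lemma category_plus:
  assumes "category G" "category H"
  shows "category (stuff_plus G H)"
proof -
  interpret G: category G by fact
  interpret H: category H by fact
  have cmp: "cmp (stuff_plus G H) (Inl f) (Inl g) = Inl (cmp G f g)"
    "cmp (stuff_plus G H) (Inr f') (Inr g') = Inr (cmp H f' g')"
    "idn (stuff_plus G H) (Inl x) = Inl (idn G x)"
    "idn (stuff_plus G H) (Inr x') = Inr (idn H x')" for f g f' g' x x'
    by (simp_all add: stuff_plus_def)
  show ?thesis
  proof
    show "src (stuff_plus G H) f \<in> obj (stuff_plus G H)" "tgt (stuff_plus G H) f \<in> obj (stuff_plus G H)"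
      if "f \<in> arr (stuff_plus G H)" for f
      using that G.src_obj G.tgt_obj H.src_obj H.tgt_obj by (auto simp: stuff_plus_def)
    show "idn (stuff_plus G H) x \<in> hom (stuff_plus G H) x x" if "x \<in> obj (stuff_plus G H)" for x
      using that G.idn_hom H.idn_hom by (auto simp: cmp hom_plus)
    show "cmp (stuff_plus G H) g f \<in> hom (stuff_plus G H) x z"
      if "f \<in> hom (stuff_plus G H) x y" "g \<in> hom (stuff_plus G H) y z" for f g x y z
      using that by (cases x; cases y; cases z) (auto simp: cmp hom_plus intro: G.cmp_hom H.cmp_hom)
    show "cmp (stuff_plus G H) f (idn (stuff_plus G H) x) = f"
      if "f \<in> hom (stuff_plus G H) x y" for f x y
      using that by (cases x; cases y) (auto simp: cmp hom_plus G.cmp_idn_right H.cmp_idn_right)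
    show "cmp (stuff_plus G H) (idn (stuff_plus G H) y) f = f"
      if "f \<in> hom (stuff_plus G H) x y" for f x y
      using that by (cases x; cases y) (auto simp: cmp hom_plus G.cmp_idn_left H.cmp_idn_left)
    show "cmp (stuff_plus G H) h (cmp (stuff_plus G H) g f) = cmp (stuff_plus G H) (cmp (stuff_plus G H) h g) f"
      if "f \<in> hom (stuff_plus G H) w x" "g \<in> hom (stuff_plus G H) x y" "h \<in> hom (stuff_plus G H) y z"
      for f g h w x y z
      using that by (cases w; cases x; cases y; cases z) (auto simp: cmp hom_plus G.cmp_assoc H.cmp_assoc)
  qed
qed

lemma graded_category_plus:
  assumes "graded_category G" "graded_category H"
  shows "graded_category (stuff_plus G H)"
  unfolding graded_category_def
proof (intro conjI ballI allI impI)
  show "category (stuff_plus G H)"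
    using assms by (intro category_plus) (simp_all add: graded_category_def)
  show "finite (Aut (stuff_plus G H) x)" "finite (fobj (und (stuff_plus G H)) x)"
    if "x \<in> obj (stuff_plus G H)" for x
    using that assms by (auto simp: graded_category_def isos_plus)
  show "card (fobj (und (stuff_plus G H)) x) = card (fobj (und (stuff_plus G H)) y)"
    if "isos (stuff_plus G H) x y \<noteq> {}" for x y
    using that assms by (cases x; cases y) (auto simp: graded_category_def isos_plus)
qed

lemma has_series_plus:
  assumes "has_series G a" "has_series H b"
  shows "has_series (stuff_plus G H) (a + b)"
proof -
  obtain R where R: "transversal G R" "graded_category G"
    and a: "\<And>n. ((\<lambda>x. 1 / real (card (Aut G x))) has_sum fps_nth a n) {x \<in> R. card (fobj (und G) x) = n}"
    using assms(1) by (auto simp: has_series_def)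
  obtain S where S: "transversal H S" "graded_category H"
    and b: "\<And>n. ((\<lambda>x. 1 / real (card (Aut H x))) has_sum fps_nth b n) {x \<in> S. card (fobj (und H) x) = n}"
    using assms(2) by (auto simp: has_series_def)
  have "transversal (stuff_plus G H) (R <+> S)"
  proof (rule transversalI)
    show "\<exists>r\<in>R <+> S. isos (stuff_plus G H) x r \<noteq> {}" if x: "x \<in> obj (stuff_plus G H)" for x
    proof (cases x)
      case (Inl u)
      then obtain r where "r \<in> R" "isos G u r \<noteq> {}"
        using x transversalD(2)[OF R(1), of u] by auto
      then show ?thesis
        using Inl by (intro bexI[of _ "Inl r"]) (auto simp: isos_plus)
    next
      case (Inr v)
      then obtain s where "s \<in> S" "isos H v s \<noteq> {}"
        using x transversalD(2)[OF S(1), of v] by auto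
      then show ?thesis
        using Inr by (intro bexI[of _ "Inr s"]) (auto simp: isos_plus)
    qed
    show "r = s" if x: "x \<in> obj (stuff_plus G H)" and rs: "r \<in> R <+> S" "s \<in> R <+> S"
      "isos (stuff_plus G H) x r \<noteq> {}" "isos (stuff_plus G H) x s \<noteq> {}" for x r s
    proof (cases x)
      case (Inl u)
      then obtain r' s' where "r = Inl r'" "s = Inl s'" "r' \<in> R" "s' \<in> R"
        "isos G u r' \<noteq> {}" "isos G u s' \<noteq> {}"
        using rs by (cases r; cases s) (auto simp: isos_plus)
      then show ?thesis
        using transversalD(3)[OF R(1), of u r' s'] Inl x by auto
    next
      case (Inr v)
      then obtain r' s' where "r = Inr r'" "s = Inr s'" "r' \<in> S" "s' \<in> S"
        "isos H v r' \<noteq> {}" "isos H v s' \<noteq> {}"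
        using rs by (cases r; cases s) (auto simp: isos_plus)
      then show ?thesis
        using transversalD(3)[OF S(1), of v r' s'] Inr x by auto
    qed
  qed (use transversalD(1)[OF R(1)] transversalD(1)[OF S(1)] in auto)
  moreover have "((\<lambda>x. 1 / real (card (Aut (stuff_plus G H) x))) has_sum fps_nth (a + b) n)
      {x \<in> R <+> S. card (fobj (und (stuff_plus G H)) x) = n}" (is "(?w has_sum _) ?A") for n
  proof -
    have "(?w has_sum fps_nth a n) (Inl ` {x \<in> R. card (fobj (und G) x) = n})"
      using a by (subst has_sum_reindex) (auto simp: isos_plus card_image o_def)
    moreover have "(?w has_sum fps_nth b n) (Inr ` {x \<in> S. card (fobj (und H) x) = n})"
      using b by (subst has_sum_reindex) (auto simp: isos_plus card_image o_def)
    ultimately have "(?w has_sum fps_nth a n + fps_nth b n)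
      (Inl ` {x \<in> R. card (fobj (und G) x) = n} \<union> Inr ` {x \<in> S. card (fobj (und H) x) = n})"
      by (rule has_sum_Un_disjoint) auto
    also have "Inl ` {x \<in> R. card (fobj (und G) x) = n} \<union> Inr ` {x \<in> S. card (fobj (und H) x) = n} = ?A"
      by auto
    finally show ?thesis by simp
  qed
  ultimately show ?thesis
    using graded_category_plus[OF R(2) S(2)] by (auto simp: has_series_def)
qed

lemma hom_sum:
  "hom (stuff_sum I G) (i, x) (j, y) = (if i = j \<and> i \<in> I then Pair i ` hom (G i) x y else {})"
  by (auto simp: hom_def stuff_sum_def)

lemma stuff_sum_simps [simp]:
  "obj (stuff_sum I G) = (SIGMA i:I. obj (G i))"
  "fobj (und (stuff_sum I G)) (i, x) = fobj (und (G i)) x"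
  "idn (stuff_sum I G) (i, x) = (i, idn (G i) x)"
  "cmp (stuff_sum I G) (j, g) (i, f) = (i, cmp (G i) g f)"
  by (simp_all add: stuff_sum_def)

lemma isos_sum:
  "isos (stuff_sum I G) (i, x) (j, y) = (if i = j \<and> i \<in> I then Pair i ` isos (G i) x y else {})"
  unfolding isos_def hom_sum by (auto simp: image_iff)

lemma category_sum:
  assumes "\<And>i. i \<in> I \<Longrightarrow> category (G i)"
  shows "category (stuff_sum I G)"
proof
  show "src (stuff_sum I G) f \<in> obj (stuff_sum I G)" "tgt (stuff_sum I G) f \<in> obj (stuff_sum I G)"
    if "f \<in> arr (stuff_sum I G)" for f
    using that category.src_obj[OF assms] category.tgt_obj[OF assms] by (auto simp: stuff_sum_def)
  show "idn (stuff_sum I G) x \<in> hom (stuff_sum I G) x x" if "x \<in> obj (stuff_sum I G)" for x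
    using that category.idn_hom[OF assms] by (cases x) (auto simp: hom_sum)
  show "cmp (stuff_sum I G) g f \<in> hom (stuff_sum I G) x z"
    if "f \<in> hom (stuff_sum I G) x y" "g \<in> hom (stuff_sum I G) y z" for f g x y z
    using that by (cases x; cases y; cases z)
      (auto simp: hom_sum intro: category.cmp_hom[OF assms] split: if_splits)
  show "cmp (stuff_sum I G) f (idn (stuff_sum I G) x) = f" if "f \<in> hom (stuff_sum I G) x y" for f x y
    using that by (cases x; cases y) (auto simp: hom_sum category.cmp_idn_right[OF assms] split: if_splits)
  show "cmp (stuff_sum I G) (idn (stuff_sum I G) y) f = f" if "f \<in> hom (stuff_sum I G) x y" for f x y
    using that by (cases x; cases y) (auto simp: hom_sum category.cmp_idn_left[OF assms] split: if_splits)
  show "cmp (stuff_sum I G) h (cmp (stuff_sum I G) g f) = cmp (stuff_sum I G) (cmp (stuff_sum I G) h g) f"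
    if "f \<in> hom (stuff_sum I G) w x" "g \<in> hom (stuff_sum I G) x y" "h \<in> hom (stuff_sum I G) y z"
    for f g h w x y z
    using that by (cases w; cases x; cases y; cases z)
      (auto simp: hom_sum category.cmp_assoc[OF assms] split: if_splits)
qed

lemma graded_category_sum:
  assumes "\<And>i. i \<in> I \<Longrightarrow> graded_category (G i)"
  shows "graded_category (stuff_sum I G)"
  unfolding graded_category_def
proof (intro conjI ballI allI impI)
  show "category (stuff_sum I G)"
    using assms by (intro category_sum) (simp add: graded_category_def)
  show "finite (Aut (stuff_sum I G) x)" "finite (fobj (und (stuff_sum I G)) x)"
    if "x \<in> obj (stuff_sum I G)" for x
    using that assms by (auto simp: graded_category_def isos_sum)
  show "card (fobj (und (stuff_sum I G)) x) = card (fobj (und (stuff_sum I G)) y)"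
    if "isos (stuff_sum I G) x y \<noteq> {}" for x y
    using that assms by (cases x; cases y) (auto simp: graded_category_def isos_sum split: if_splits)
qed

lemma has_series_sum:
  assumes fin: "finite I" and G: "\<And>i. i \<in> I \<Longrightarrow> has_series (G i) (a i)"
  shows "has_series (stuff_sum I G) (\<Sum>i\<in>I. a i)"
proof -
  have "\<forall>i\<in>I. \<exists>R. transversal (G i) R \<and> (\<forall>n. ((\<lambda>x. 1 / real (card (Aut (G i) x))) has_sum fps_nth (a i) n)
      {x \<in> R. card (fobj (und (G i)) x) = n})"
    using G by (simp add: has_series_def)
  from bchoice[OF this] obtain R where RI: "\<forall>i\<in>I. transversal (G i) (R i) \<and>
      (\<forall>n. ((\<lambda>x. 1 / real (card (Aut (G i) x))) has_sum fps_nth (a i) n)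
        {x \<in> R i. card (fobj (und (G i)) x) = n})" ..
  have R: "transversal (G i) (R i)" if "i \<in> I" for i
    using RI that by simp
  have a: "((\<lambda>x. 1 / real (card (Aut (G i) x))) has_sum fps_nth (a i) n)
      {x \<in> R i. card (fobj (und (G i)) x) = n}" if "i \<in> I" for i n
    using RI that by simp
  have "transversal (stuff_sum I G) (SIGMA i:I. R i)"
  proof (rule transversalI)
    show "\<exists>r\<in>SIGMA i:I. R i. isos (stuff_sum I G) x r \<noteq> {}" if x: "x \<in> obj (stuff_sum I G)" for x
    proof (cases x)
      case (Pair i u)
      then obtain r where "r \<in> R i" "isos (G i) u r \<noteq> {}" "i \<in> I"
        using x transversalD(2)[OF R, of i u] by auto
      then show ?thesis
        using Pair by (intro bexI[of _ "(i, r)"]) (auto simp: isos_sum)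
    qed
    show "r = s" if x: "x \<in> obj (stuff_sum I G)" and rs: "r \<in> (SIGMA i:I. R i)" "s \<in> (SIGMA i:I. R i)"
      "isos (stuff_sum I G) x r \<noteq> {}" "isos (stuff_sum I G) x s \<noteq> {}" for x r s
    proof (cases x)
      case (Pair i u)
      then obtain r' s' where "r = (i, r')" "s = (i, s')" "i \<in> I" "r' \<in> R i" "s' \<in> R i"
        "isos (G i) u r' \<noteq> {}" "isos (G i) u s' \<noteq> {}"
        using rs by (cases r; cases s) (auto simp: isos_sum split: if_splits)
      then show ?thesis
        using transversalD(3)[OF R, of i u r' s'] Pair x by auto
    qed
  qed (use transversalD(1)[OF R] in auto)
  moreover have "((\<lambda>x. 1 / real (card (Aut (stuff_sum I G) x))) has_sum fps_nth (\<Sum>i\<in>I. a i) n)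
      {x \<in> (SIGMA i:I. R i). card (fobj (und (stuff_sum I G)) x) = n}" (is "(?w has_sum _) ?A") for n
  proof -
    have inner: "((\<lambda>x. ?w (i, x)) has_sum fps_nth (a i) n) {x \<in> R i. card (fobj (und (G i)) x) = n}"
      if "i \<in> I" for i
      using a[OF that] that by (simp add: isos_sum card_image inj_on_def)
    have outer: "((\<lambda>i. fps_nth (a i) n) has_sum fps_nth (\<Sum>i\<in>I. a i) n) I"
      using fin by (simp add: fps_sum_nth has_sum_finite)
    have "(?w has_sum fps_nth (\<Sum>i\<in>I. a i) n) (SIGMA i:I. {x \<in> R i. card (fobj (und (G i)) x) = n})"
      by (rule has_sum_SigmaI[OF inner outer], assumption)
        (rule summable_on_SigmaI[OF inner summable_on_finite[OF fin]], auto)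
    also have "(SIGMA i:I. {x \<in> R i. card (fobj (und (G i)) x) = n}) = ?A"
      by auto
    finally show ?thesis .
  qed
  ultimately show ?thesis
    using graded_category_sum[of I G] G by (auto simp: has_series_def)
qed

section \<open>Partitional products\<close>

lemma hom_times: "hom (stuff_times G H) (x, y) (x', y') = hom G x x' \<times> hom H y y'"
  by (auto simp: hom_def stuff_times_def)

lemma stuff_times_simps [simp]:
  "obj (stuff_times G H) = obj G \<times> obj H"
  "fobj (und (stuff_times G H)) (x, y) = fobj (und G) x \<squnion>\<^sub>s fobj (und H) y"
  "idn (stuff_times G H) (x, y) = (idn G x, idn H y)"
  "cmp (stuff_times G H) (g, g') (f, f') = (cmp G g f, cmp H g' f')"
  by (simp_all add: stuff_times_def)

lemma isos_times: "isos (stuff_times G H) (x, y) (x', y') = isos G x x' \<times> isos H y y'"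
  unfolding isos_def hom_times by (fastforce simp: hom_times)

lemma finite_dunion: "finite A \<Longrightarrow> finite B \<Longrightarrow> finite (A \<squnion>\<^sub>s B)"
  by (simp add: dunion_def)

lemma card_dunion:
  assumes "finite A" "finite B"
  shows "card (A \<squnion>\<^sub>s B) = card A + card B"
  unfolding dunion_def using assms by (subst card_Un_disjoint) (auto simp: card_image inj_on_def)

lemma category_times:
  assumes "category G" "category H"
  shows "category (stuff_times G H)"
proof -
  interpret G: category G by fact
  interpret H: category H by fact
  show ?thesis
  proof
    show "src (stuff_times G H) f \<in> obj (stuff_times G H)" "tgt (stuff_times G H) f \<in> obj (stuff_times G H)"
      if "f \<in> arr (stuff_times G H)" for f
      using that G.src_obj G.tgt_obj H.src_obj H.tgt_obj by (auto simp: stuff_times_def)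
  qed (auto simp: hom_times G.cmp_assoc H.cmp_assoc
      intro: G.idn_hom H.idn_hom G.cmp_hom H.cmp_hom G.cmp_idn_right H.cmp_idn_right
        G.cmp_idn_left H.cmp_idn_left)
qed

lemma graded_category_times:
  assumes "graded_category G" "graded_category H"
  shows "graded_category (stuff_times G H)"
  unfolding graded_category_def
proof (intro conjI ballI allI impI)
  show "category (stuff_times G H)"
    using assms by (intro category_times) (simp_all add: graded_category_def)
  show "finite (Aut (stuff_times G H) x)" "finite (fobj (und (stuff_times G H)) x)"
    if "x \<in> obj (stuff_times G H)" for x
    using that assms by (auto simp: graded_category_def isos_times finite_dunion)
  show "card (fobj (und (stuff_times G H)) x) = card (fobj (und (stuff_times G H)) y)"
    if "isos (stuff_times G H) x y \<noteq> {}" for x y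
  proof (cases x; cases y)
    fix u v u' v' assume eq: "x = (u, v)" "y = (u', v')"
    then have iso: "isos G u u' \<noteq> {}" "isos H v v' \<noteq> {}"
      using that by (auto simp: isos_times)
    then have "u \<in> obj G" "u' \<in> obj G" "v \<in> obj H" "v' \<in> obj H"
      using category.isos_obj assms by (metis graded_category_def)+
    then show ?thesis
      using assms iso by (simp add: graded_category_def card_dunion eq)
  qed
qed

text \<open>Automorphisms of a pair are pairs of automorphisms, so weights multiply, while degrees
  add under disjoint union. Splitting the pairs of degree \<open>n\<close> by the degree
  \<open>i\<close> of the first component gives the Cauchy product.\<close>

lemma has_series_times:
  assumes "has_series G a" "has_series H b"
  shows "has_series (stuff_times G H) (a * b)"
proof -
  obtain R where R: "transversal G R" "graded_category G"
    and a: "\<And>n. ((\<lambda>x. 1 / real (card (Aut G x))) has_sum fps_nth a n) {x \<in> R. card (fobj (und G) x) = n}"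
    using assms(1) by (auto simp: has_series_def)
  obtain S where S: "transversal H S" "graded_category H"
    and b: "\<And>n. ((\<lambda>x. 1 / real (card (Aut H x))) has_sum fps_nth b n) {x \<in> S. card (fobj (und H) x) = n}"
    using assms(2) by (auto simp: has_series_def)
  define A where "A k = {x \<in> R. card (fobj (und G) x) = k}" for k
  define B where "B k = {y \<in> S. card (fobj (und H) y) = k}" for k
  have "transversal (stuff_times G H) (R \<times> S)"
  proof (rule transversalI)
    show "\<exists>r\<in>R \<times> S. isos (stuff_times G H) x r \<noteq> {}" if x: "x \<in> obj (stuff_times G H)" for x
    proof (cases x)
      case (Pair u v)
      then obtain r s where "r \<in> R" "s \<in> S" "isos G u r \<noteq> {}" "isos H v s \<noteq> {}"
        using x transversalD(2)[OF R(1), of u] transversalD(2)[OF S(1), of v] by auto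
      then show ?thesis
        using Pair by (auto simp: isos_times intro!: bexI[of _ "(r, s)"])
    qed
    show "r = s" if x: "x \<in> obj (stuff_times G H)" and rs: "r \<in> R \<times> S" "s \<in> R \<times> S"
      "isos (stuff_times G H) x r \<noteq> {}" "isos (stuff_times G H) x s \<noteq> {}" for x r s
    proof (cases x)
      case (Pair u v)
      obtain r1 r2 s1 s2 where "r = (r1, r2)" "s = (s1, s2)"
        by (cases r; cases s)
      then show ?thesis
        using transversalD(3)[OF R(1), of u r1 s1] transversalD(3)[OF S(1), of v r2 s2] Pair x rs
        by (simp add: isos_times)
    qed
  qed (use transversalD(1)[OF R(1)] transversalD(1)[OF S(1)] in auto)
  moreover have "((\<lambda>x. 1 / real (card (Aut (stuff_times G H) x))) has_sum fps_nth (a * b) n)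
      {x \<in> R \<times> S. card (fobj (und (stuff_times G H)) x) = n}" (is "(?w has_sum _) ?A") for n
  proof -
    have w: "?w (x, y) = (1 / real (card (Aut G x))) * (1 / real (card (Aut H y)))" for x y
      by (simp add: isos_times card_cartesian_product)
    have prod: "(?w has_sum fps_nth a i * fps_nth b j) (A i \<times> B j)" for i j
    proof -
      have inner: "((\<lambda>y. ?w (x, y)) has_sum (1 / real (card (Aut G x))) * fps_nth b j) (B j)" for x
        unfolding w using b by (intro has_sum_cmult_right) (simp add: B_def)
      have outer: "((\<lambda>x. (1 / real (card (Aut G x))) * fps_nth b j) has_sum fps_nth a i * fps_nth b j) (A i)"
        using a by (intro has_sum_cmult_left) (simp add: A_def)
      show ?thesis
        by (rule has_sum_SigmaI[OF inner outer])
          (rule summable_on_SigmaI[OF inner], use outer in \<open>auto intro: has_sum_imp_summable\<close>)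
    qed
    have outer: "((\<lambda>i. fps_nth a i * fps_nth b (n - i)) has_sum fps_nth (a * b) n) {0..n}"
      by (simp add: fps_mult_nth has_sum_finite)
    \<comment> \<open>Each pair is tagged with the degree \<open>i\<close> of its first component,
      so that the blocks \<open>A i \<times> B (n - i)\<close> form a dependent sum.\<close>
    have inner: "((\<lambda>x. ?w (snd (i, x))) has_sum fps_nth a i * fps_nth b (n - i)) (A i \<times> B (n - i))" for i
      using prod by simp
    have "((\<lambda>p. ?w (snd p)) has_sum fps_nth (a * b) n) (SIGMA i:{0..n}. A i \<times> B (n - i))"
      by (rule has_sum_SigmaI[OF inner outer]) (rule summable_on_SigmaI[OF inner], auto)
    \<comment> \<open>Dropping the tag loses nothing, since it can be recomputed from the first
      component.\<close>
    moreover have "bij_betw snd (SIGMA i:{0..n}. A i \<times> B (n - i)) ?A"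
    proof (rule bij_betw_byWitness[where f' = "\<lambda>(x, y). (card (fobj (und G) x), (x, y))"])
      have card: "card (fobj (und (stuff_times G H)) (x, y)) = card (fobj (und G) x) + card (fobj (und H) y)"
        if "x \<in> R" "y \<in> S" for x y
        using that transversalD(1)[OF R(1)] transversalD(1)[OF S(1)] R(2) S(2)
        by (simp add: card_dunion graded_category_def)
      show "snd ` (SIGMA i:{0..n}. A i \<times> B (n - i)) \<subseteq> ?A"
        using card by (auto simp: A_def B_def simp del: stuff_times_simps)
      show "(\<lambda>(x, y). (card (fobj (und G) x), (x, y))) ` ?A \<subseteq> (SIGMA i:{0..n}. A i \<times> B (n - i))"
        using card by (auto simp: A_def B_def simp del: stuff_times_simps)
    qed (auto simp: A_def)
    ultimately show ?thesis
      using has_sum_reindex_bij_betw by blast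
  qed
  ultimately show ?thesis
    using graded_category_times[OF R(2) S(2)] by (auto simp: has_series_def)
qed

section \<open>Powers and total orders\<close>

text \<open>Produces a series for \<open>H\<close>, which \<open>has_series_unique\<close> cannot do
  as it presupposes both. A bijection on objects suffices, without an action on morphisms, because
  the series depends only on which objects are isomorphic, on automorphism counts and on
  degrees.\<close>

lemma has_series_transfer:
  assumes G: "has_series G a" and H: "category H" and bij: "bij_betw \<phi> (obj G) (obj H)"
    and iso: "\<And>x y. x \<in> obj G \<Longrightarrow> y \<in> obj G \<Longrightarrow> isos H (\<phi> x) (\<phi> y) \<noteq> {} \<longleftrightarrow> isos G x y \<noteq> {}"
    and Aut: "\<And>x. x \<in> obj G \<Longrightarrow> card (Aut H (\<phi> x)) = card (Aut G x)"
    and fin: "\<And>x. x \<in> obj G \<Longrightarrow> finite (fobj (und H) (\<phi> x))"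
    and deg: "\<And>x. x \<in> obj G \<Longrightarrow> card (fobj (und H) (\<phi> x)) = card (fobj (und G) x)"
  shows "has_series H a"
proof -
  have gG: "graded_category G" using G by (simp add: has_series_def)
  then have cG: "category G" by (simp add: graded_category_def)
  obtain R where R: "transversal G R"
    and a: "\<And>n. ((\<lambda>x. 1 / real (card (Aut G x))) has_sum fps_nth a n) {x \<in> R. card (fobj (und G) x) = n}"
    using G by (auto simp: has_series_def)
  note RD = transversalD[OF R]
  have objH: "\<exists>x\<in>obj G. y = \<phi> x" if "y \<in> obj H" for y
    using bij that by (auto simp: bij_betw_def)
  have mem: "\<phi> x \<in> obj H" if "x \<in> obj G" for x
    using bij that by (auto simp: bij_betw_def)
  have gH: "graded_category H"
    unfolding graded_category_def
  proof (intro conjI ballI allI impI H)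
    fix y assume "y \<in> obj H"
    then obtain x where x: "x \<in> obj G" "y = \<phi> x" using objH by blast
    \<comment> \<open>\<open>card\<close> of an infinite set is 0, so a nonzero count inherited from
      \<open>G\<close> proves finiteness.\<close>
    have "card (Aut H y) \<noteq> 0"
      using Aut[OF x(1)] x gG category.isos_refl[OF cG x(1)] by (simp add: graded_category_def)
    then show "finite (Aut H y)"
      by (rule contrapos_np) simp
    show "finite (fobj (und H) y)" using fin x by simp
  next
    fix y z assume yz: "isos H y z \<noteq> {}"
    then have "y \<in> obj H" "z \<in> obj H"
      using category.isos_obj[OF H] by blast+
    then obtain u v where "u \<in> obj G" "y = \<phi> u" "v \<in> obj G" "z = \<phi> v" using objH by blast
    then show "card (fobj (und H) y) = card (fobj (und H) z)"
      using yz iso deg gG by (simp add: graded_category_def)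
  qed
  have "transversal H (\<phi> ` R)"
  proof (rule transversalI)
    show "r \<in> obj H" if "r \<in> \<phi> ` R" for r
      using that RD(1) mem by blast
    show "\<exists>r\<in>\<phi> ` R. isos H y r \<noteq> {}" if "y \<in> obj H" for y
    proof -
      obtain x where x: "x \<in> obj G" "y = \<phi> x" using objH \<open>y \<in> obj H\<close> by blast
      obtain r where r: "r \<in> R" "isos G x r \<noteq> {}" using RD(2)[OF x(1)] by blast
      then show ?thesis
        using iso[OF x(1) RD(1)[OF r(1)]] x(2) by blast
    qed
    show "r = s" if y: "y \<in> obj H" and rs: "r \<in> \<phi> ` R" "s \<in> \<phi> ` R"
      "isos H y r \<noteq> {}" "isos H y s \<noteq> {}" for y r s
    proof -
      obtain x where x: "x \<in> obj G" "y = \<phi> x" using objH y by blast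
      obtain r' s' where r': "r' \<in> R" "r = \<phi> r'" "s' \<in> R" "s = \<phi> s'" using rs by blast
      then have "r' = s'"
        using RD(3)[OF x(1) r'(1,3)] iso[OF x(1) RD(1)[OF r'(1)]] iso[OF x(1) RD(1)[OF r'(3)]] rs(3,4) x(2)
        by simp
      then show ?thesis using r' by simp
    qed
  qed
  moreover have "((\<lambda>y. 1 / real (card (Aut H y))) has_sum fps_nth a n) {y \<in> \<phi> ` R. card (fobj (und H) y) = n}" for n
  proof -
    have "inj_on \<phi> (obj G)" using bij by (simp add: bij_betw_def)
    then have "bij_betw \<phi> {x \<in> R. card (fobj (und G) x) = n} {y \<in> \<phi> ` R. card (fobj (und H) y) = n}"
      unfolding bij_betw_def using RD(1) deg by (auto simp: inj_on_def)
    then have "((\<lambda>x. 1 / real (card (Aut H (\<phi> x)))) has_sum fps_nth a n) {x \<in> R. card (fobj (und G) x) = n}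
      \<longleftrightarrow> ?thesis"
      by (rule has_sum_reindex_bij_betw)
    moreover have "((\<lambda>x. 1 / real (card (Aut H (\<phi> x)))) has_sum fps_nth a n) {x \<in> R. card (fobj (und G) x) = n}"
      using a[of n] by (rule has_sum_cong[THEN iffD1, rotated]) (use RD(1) Aut in simp)
    ultimately show ?thesis by blast
  qed
  ultimately show ?thesis
    using gH by (auto simp: has_series_def)
qed

text \<open>With exactly one arrow between any two objects there is a single isomorphism class, of
  weight 1 and degree \<open>k\<close>. This covers \<open>stuff_one\<close>, the zeroth power and
  \<open>stuff_Z k\<close>.\<close>

lemma has_series_rigid:
  assumes cat: "category G" and x0: "x0 \<in> obj G"
    and hom: "\<And>x y. x \<in> obj G \<Longrightarrow> y \<in> obj G \<Longrightarrow> \<exists>!f. f \<in> hom G x y"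
    and fin: "\<And>x. x \<in> obj G \<Longrightarrow> finite (fobj (und G) x)"
    and deg: "\<And>x. x \<in> obj G \<Longrightarrow> card (fobj (und G) x) = k"
  shows "has_series G (fps_X ^ k)"
proof -
  interpret category G by fact
  have isos: "isos G x y = hom G x y" if xy: "x \<in> obj G" "y \<in> obj G" for x y
  proof
    show "hom G x y \<subseteq> isos G x y"
    proof
      fix f assume f: "f \<in> hom G x y"
      obtain g where g: "g \<in> hom G y x" using hom xy by blast
      \<comment> \<open>Each composite is an endomorphism, and the identity is the only one.\<close>
      have "cmp G g f = idn G x" "cmp G f g = idn G y"
        using hom[OF xy(1,1)] hom[OF xy(2,2)] cmp_hom[OF f g] cmp_hom[OF g f] idn_hom xy by blast+
      then show "f \<in> isos G x y" by (rule isosI[OF f g])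
    qed
  qed (auto simp: isos_def)
  have Aut: "is_singleton (Aut G x)" if "x \<in> obj G" for x
    using hom[OF that that] isos[OF that that] by (auto simp: is_singleton_def)
  have ne: "isos G x y \<noteq> {}" if "x \<in> obj G" "y \<in> obj G" for x y
    using hom[OF that] isos[OF that] by auto
  have "graded_category G"
    unfolding graded_category_def
  proof (intro conjI ballI allI impI cat fin)
    show "finite (Aut G x)" if "x \<in> obj G" for x
      using Aut[OF that] by (auto simp: is_singleton_def)
    show "card (fobj (und G) x) = card (fobj (und G) y)" if "isos G x y \<noteq> {}" for x y
      using isos_obj[OF that] deg by simp
  qed
  moreover have "transversal G {x0}"
    by (rule transversalI) (use x0 ne in auto)
  moreover have "((\<lambda>x. 1 / real (card (Aut G x))) has_sum fps_nth (fps_X ^ k) n) {x \<in> {x0}. card (fobj (und G) x) = n}" for n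
  proof -
    have "card (Aut G x0) = 1"
      using Aut[OF x0] by (simp add: is_singleton_altdef)
    then show ?thesis
      by (intro has_sum_finiteI) (auto simp: deg[OF x0] Collect_conv_if)
  qed
  ultimately show ?thesis
    unfolding has_series_def by blast
qed

lemma has_series_one: "has_series stuff_one 1"
proof -
  have "category stuff_one"
    by unfold_locales (auto simp: stuff_one_def hom_def)
  then have "has_series stuff_one (fps_X ^ 0)"
    by (rule has_series_rigid) (auto simp: stuff_one_def hom_def)
  then show ?thesis by simp
qed

lemma hom_power:
  "fs \<in> hom (stuff_power G k) xs ys \<longleftrightarrow> length fs = k \<and> length xs = k \<and> length ys = k \<and>
     (\<forall>i<k. fs ! i \<in> hom G (xs ! i) (ys ! i))"
  by (auto simp: hom_def stuff_power_def list_eq_iff_nth_eq set_conv_nth)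

lemma stuff_power_simps [simp]:
  "obj (stuff_power G k) = {xs. length xs = k \<and> set xs \<subseteq> obj G}"
  "idn (stuff_power G k) = map (idn G)"
  "cmp (stuff_power G k) = map2 (cmp G)"
  "fobj (und (stuff_power G k)) [] = {}"
  by (simp_all add: stuff_power_def)

lemma isos_power:
  "fs \<in> isos (stuff_power G k) xs ys \<longleftrightarrow> length fs = k \<and> length xs = k \<and> length ys = k \<and>
     (\<forall>i<k. fs ! i \<in> isos G (xs ! i) (ys ! i))" (is "?l \<longleftrightarrow> ?r")
proof
  assume ?l
  then obtain gs where "fs \<in> hom (stuff_power G k) xs ys" "gs \<in> hom (stuff_power G k) ys xs"
    "map2 (cmp G) gs fs = map (idn G) xs" "map2 (cmp G) fs gs = map (idn G) ys"
    by (auto simp: isos_def)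
  then show ?r
    by (auto simp: hom_power list_eq_iff_nth_eq intro!: isosI)
next
  assume r: ?r
  then have "\<forall>i\<in>{..<k}. \<exists>g. g \<in> hom G (ys ! i) (xs ! i) \<and> cmp G g (fs ! i) = idn G (xs ! i) \<and>
      cmp G (fs ! i) g = idn G (ys ! i)"
    by (auto simp: isos_def)
  from bchoice[OF this] obtain g where g: "\<forall>i\<in>{..<k}. g i \<in> hom G (ys ! i) (xs ! i) \<and>
      cmp G (g i) (fs ! i) = idn G (xs ! i) \<and> cmp G (fs ! i) (g i) = idn G (ys ! i)" ..
  show ?l
    by (rule isosI[where g = "map g [0..<k]"])
      (use r g in \<open>auto simp: hom_power isos_def intro!: nth_equalityI\<close>)
qed

lemma category_power:
  assumes "category G"
  shows "category (stuff_power G k)"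
proof -
  interpret category G by fact
  show ?thesis
  proof
    show "src (stuff_power G k) f \<in> obj (stuff_power G k)" "tgt (stuff_power G k) f \<in> obj (stuff_power G k)"
      if "f \<in> arr (stuff_power G k)" for f
      using that src_obj tgt_obj by (auto simp: stuff_power_def)
    show "idn (stuff_power G k) x \<in> hom (stuff_power G k) x x" if "x \<in> obj (stuff_power G k)" for x
      using that by (auto simp: hom_power intro!: idn_hom)
    show "cmp (stuff_power G k) g f \<in> hom (stuff_power G k) x z"
      if "f \<in> hom (stuff_power G k) x y" "g \<in> hom (stuff_power G k) y z" for f g x y z
      using that by (auto simp: hom_power intro!: cmp_hom)
    show "cmp (stuff_power G k) f (idn (stuff_power G k) x) = f" if "f \<in> hom (stuff_power G k) x y" for f x y
      using that by (auto simp: hom_power intro!: nth_equalityI cmp_idn_right)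
    show "cmp (stuff_power G k) (idn (stuff_power G k) y) f = f" if "f \<in> hom (stuff_power G k) x y" for f x y
      using that by (auto simp: hom_power intro!: nth_equalityI cmp_idn_left)
    show "cmp (stuff_power G k) h (cmp (stuff_power G k) g f) = cmp (stuff_power G k) (cmp (stuff_power G k) h g) f"
      if "f \<in> hom (stuff_power G k) w x" "g \<in> hom (stuff_power G k) x y" "h \<in> hom (stuff_power G k) y z"
      for f g h w x y z
      using that by (auto simp: hom_power intro!: nth_equalityI cmp_assoc)
  qed
qed

lemma isos_power_Cons:
  "isos (stuff_power G (Suc k)) (x # xs) (y # ys) =
     (\<lambda>(f, fs). f # fs) ` (isos G x y \<times> isos (stuff_power G k) xs ys)"
proof (rule set_eqI)
  fix fs
  show "fs \<in> isos (stuff_power G (Suc k)) (x # xs) (y # ys) \<longleftrightarrow>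
      fs \<in> (\<lambda>(f, fs). f # fs) ` (isos G x y \<times> isos (stuff_power G k) xs ys)"
    by (cases fs) (auto simp: isos_power All_less_Suc2)
qed

lemma has_series_power:
  assumes "has_series G a"
  shows "has_series (stuff_power G k) (a ^ k)"
proof (induction k)
  case 0
  have "category G" using assms by (simp add: has_series_def graded_category_def)
  \<comment> \<open>The only object is the empty list, and its only arrow is the empty list of
    arrows.\<close>
  then have "has_series (stuff_power G 0) (fps_X ^ 0)"
    by (intro has_series_rigid[of _ "[]"] category_power) (auto simp: hom_power)
  then show ?case by simp
next
  case (Suc k)
  have gG: "graded_category G" and gk: "graded_category (stuff_power G k)"
    using assms Suc by (simp_all add: has_series_def)
  have "has_series (stuff_power G (Suc k)) (a * a ^ k)"
  proof (rule has_series_transfer[OF has_series_times[OF assms Suc], of _ "\<lambda>(x, xs). x # xs"])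
    show "category (stuff_power G (Suc k))"
      using gG by (intro category_power) (simp add: graded_category_def)
    show "bij_betw (\<lambda>(x, xs). x # xs) (obj (stuff_times G (stuff_power G k))) (obj (stuff_power G (Suc k)))"
      by (auto simp: bij_betw_def inj_on_def image_iff length_Suc_conv)
    fix u assume u: "u \<in> obj (stuff_times G (stuff_power G k))"
    obtain x xs where u_eq: "u = (x, xs)" by (cases u)
    have und: "fobj (und (stuff_power G (Suc k))) (x # xs) = fobj (und G) x \<squnion>\<^sub>s fobj (und (stuff_power G k)) xs"
      by (simp add: stuff_power_def)
    have inj: "inj_on (\<lambda>(f, fs). f # fs) A" for A :: "('b \<times> 'b list) set"
      by (auto simp: inj_on_def)
    show "card (Aut (stuff_power G (Suc k)) (case u of (x, xs) \<Rightarrow> x # xs)) = card (Aut (stuff_times G (stuff_power G k)) u)"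
      by (simp add: u_eq isos_power_Cons isos_times card_image inj)
    show "finite (fobj (und (stuff_power G (Suc k))) (case u of (x, xs) \<Rightarrow> x # xs))"
      using gG gk u unfolding u_eq prod.case und graded_category_def by (auto intro!: finite_dunion)
    show "card (fobj (und (stuff_power G (Suc k))) (case u of (x, xs) \<Rightarrow> x # xs)) =
        card (fobj (und (stuff_times G (stuff_power G k))) u)"
      unfolding u_eq prod.case und by simp
    show "(isos (stuff_power G (Suc k)) (case u of (x, xs) \<Rightarrow> x # xs) (case v of (x, xs) \<Rightarrow> x # xs) \<noteq> {}) =
        (isos (stuff_times G (stuff_power G k)) u v \<noteq> {})" for v
      by (cases v) (auto simp: u_eq isos_power_Cons isos_times)
  qed
  then show ?case by simp
qed

section \<open>Finite total orders are rigid\<close>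

lemma linear_order_onD:
  assumes "linear_order_on A r"
  shows "a \<in> A \<Longrightarrow> (a, a) \<in> r" "(a, b) \<in> r \<Longrightarrow> a \<in> A" "(a, b) \<in> r \<Longrightarrow> b \<in> A"
    "(a, b) \<in> r \<Longrightarrow> (b, a) \<in> r \<Longrightarrow> a = b" "(a, b) \<in> r \<Longrightarrow> (b, c) \<in> r \<Longrightarrow> (a, c) \<in> r"
    "a \<in> A \<Longrightarrow> b \<in> A \<Longrightarrow> (a, b) \<in> r \<or> (b, a) \<in> r"
proof -
  have r: "refl_on A r" "r \<subseteq> A \<times> A" "trans r" "antisym r" "total_on A r"
    using assms by (auto simp: order_on_defs)
  show "a \<in> A \<Longrightarrow> (a, a) \<in> r" by (rule refl_onD[OF r(1)])
  show "(a, b) \<in> r \<Longrightarrow> a \<in> A" "(a, b) \<in> r \<Longrightarrow> b \<in> A" using r(2) by auto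
  show "(a, b) \<in> r \<Longrightarrow> (b, a) \<in> r \<Longrightarrow> a = b" by (rule antisymD[OF r(4)])
  show "(a, b) \<in> r \<Longrightarrow> (b, c) \<in> r \<Longrightarrow> (a, c) \<in> r" by (rule transD[OF r(3)])
  show "a \<in> A \<Longrightarrow> b \<in> A \<Longrightarrow> (a, b) \<in> r \<or> (b, a) \<in> r"
    using r(1,5) by (cases "a = b") (auto simp: total_on_def dest: refl_onD)
qed

text \<open>The position of \<open>a\<close> in the order, counted from 0. It serves as a canonical
  coordinate that identifies any finite total order with an initial segment of the naturals.\<close>

definition order_rank :: "('b \<times> 'b) set \<Rightarrow> 'b \<Rightarrow> nat" where
  "order_rank r a = card {b. (b, a) \<in> r \<and> b \<noteq> a}"

lemma rank_mono:
  assumes A: "finite A" "linear_order_on A r" and ab: "(a, b) \<in> r" "a \<noteq> b"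
  shows "order_rank r a < order_rank r b"
  unfolding order_rank_def
proof (rule psubset_card_mono)
  note r = linear_order_onD[OF A(2)]
  show "finite {c. (c, b) \<in> r \<and> c \<noteq> b}"
    by (rule finite_subset[OF _ A(1)]) (use r(2) in blast)
  have "a \<in> {c. (c, b) \<in> r \<and> c \<noteq> b} - {c. (c, a) \<in> r \<and> c \<noteq> a}"
    using ab by simp
  moreover have "{c. (c, a) \<in> r \<and> c \<noteq> a} \<subseteq> {c. (c, b) \<in> r \<and> c \<noteq> b}"
    using r(4,5) ab by blast
  ultimately show "{c. (c, a) \<in> r \<and> c \<noteq> a} \<subset> {c. (c, b) \<in> r \<and> c \<noteq> b}"
    by blast
qed

text \<open>Totality and strict monotonicity give injectivity. Ranks stay below
  \<open>card A\<close> because \<open>a\<close> is not counted in its own rank, and equal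
  cardinalities then give surjectivity.\<close>

lemma bij_betw_rank:
  assumes A: "finite A" "linear_order_on A r"
  shows "bij_betw (order_rank r) A {..<card A}"
proof -
  note r = linear_order_onD[OF A(2)]
  have inj: "inj_on (order_rank r) A"
  proof (rule inj_onI, rule ccontr)
    fix a b assume "a \<in> A" "b \<in> A" "order_rank r a = order_rank r b" "a \<noteq> b"
    then show False
      using r(6)[of a b] rank_mono[OF A, of a b] rank_mono[OF A, of b a] by auto
  qed
  have "order_rank r a < card A" if "a \<in> A" for a
  proof -
    have "{b. (b, a) \<in> r \<and> b \<noteq> a} \<subseteq> A - {a}"
      using r(2) by blast
    then have "order_rank r a \<le> card (A - {a})"
      unfolding order_rank_def using A(1) by (intro card_mono) auto
    also have "\<dots> < card A"
      using that A(1) by (intro card_Diff1_less)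
    finally show ?thesis .
  qed
  then have "order_rank r ` A \<subseteq> {..<card A}" by auto
  moreover have "card (order_rank r ` A) = card {..<card A}"
    using inj by (simp add: card_image)
  ultimately have "order_rank r ` A = {..<card A}"
    by (intro card_subset_eq) auto
  then show ?thesis using inj by (simp add: bij_betw_def)
qed

text \<open>The map carries the strict initial segment below \<open>a\<close> bijectively onto the
  one below \<open>f a\<close>.\<close>

lemma rank_order_iso:
  assumes A: "linear_order_on A r" and B: "linear_order_on B s"
    and f: "bij_betw f A B" and mono: "\<And>u v. (u, v) \<in> r \<Longrightarrow> (f u, f v) \<in> s" and a: "a \<in> A"
  shows "order_rank s (f a) = order_rank r a"
proof -
  note r = linear_order_onD[OF A] and s = linear_order_onD[OF B]
  have inj: "inj_on f A" and surj: "f ` A = B"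
    using f by (simp_all add: bij_betw_def)
  \<comment> \<open>\<open>f\<close> also reflects the order: otherwise totality gives the opposite
    relation in \<open>A\<close>, and monotonicity with antisymmetry in \<open>B\<close> makes the
    images equal, contradicting injectivity.\<close>
  have refl: "(u, a) \<in> r" if "u \<in> A" "(f u, f a) \<in> s" for u
  proof (rule ccontr)
    assume "(u, a) \<notin> r"
    then have "(a, u) \<in> r" using r(6) that(1) a by blast
    then have "f u = f a" using mono s(4) that(2) by blast
    then have "u = a" using inj_onD[OF inj] that(1) a by blast
    then show False using \<open>(u, a) \<notin> r\<close> r(1) a by blast
  qed
  have "{b. (b, f a) \<in> s \<and> b \<noteq> f a} = f ` {b. (b, a) \<in> r \<and> b \<noteq> a}"
  proof
    show "f ` {b. (b, a) \<in> r \<and> b \<noteq> a} \<subseteq> {b. (b, f a) \<in> s \<and> b \<noteq> f a}"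
      using mono r(2) inj_onD[OF inj] a by blast
    show "{b. (b, f a) \<in> s \<and> b \<noteq> f a} \<subseteq> f ` {b. (b, a) \<in> r \<and> b \<noteq> a}"
    proof
      fix b assume b: "b \<in> {b. (b, f a) \<in> s \<and> b \<noteq> f a}"
      then obtain u where "u \<in> A" "b = f u" using s(2) surj by blast
      then show "b \<in> f ` {b. (b, a) \<in> r \<and> b \<noteq> a}" using b refl by blast
    qed
  qed
  moreover have "inj_on f {b. (b, a) \<in> r \<and> b \<noteq> a}"
    by (rule inj_on_subset[OF inj]) (use r(2) in blast)
  ultimately show ?thesis by (simp add: order_rank_def card_image)
qed

text \<open>Existence: send each element to the one of the same rank. Uniqueness: every such map
  preserves ranks, and the rank is injective on \<open>B\<close>; extensionality settles the values
  outside \<open>A\<close>.\<close>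

lemma ex1_order_iso:
  assumes A: "finite A" "linear_order_on A r" and B: "finite B" "linear_order_on B s"
    and card: "card A = card B"
  shows "\<exists>!f. f \<in> extensional A \<and> bij_betw f A B \<and> (\<forall>(u, v) \<in> r. (f u, f v) \<in> s)"
proof (rule ex_ex1I)
  note rA = bij_betw_rank[OF A] and rB = bij_betw_rank[OF B]
  define g where "g = restrict (inv_into B (order_rank s) \<circ> order_rank r) A"
  have bij: "bij_betw g A B"
    unfolding g_def using bij_betw_trans[OF rA bij_betw_inv_into[OF rB, folded card]]
    by (simp cong: bij_betw_cong)
  have ext: "g \<in> extensional A"
    by (simp add: g_def)
  have rank_g: "order_rank s (g a) = order_rank r a" if "a \<in> A" for a
  proof -
    have "order_rank r a \<in> order_rank s ` B"
      using rA rB that card by (auto simp: bij_betw_def)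
    then show ?thesis
      using that by (simp add: g_def f_inv_into_f)
  qed
  \<comment> \<open>If the order were not preserved, totality would put \<open>g v\<close> strictly
    below \<open>g u\<close>, so \<open>v\<close> would have smaller rank than \<open>u\<close>,
    against \<open>(u, v) \<in> r\<close>.\<close>
  have "(g u, g v) \<in> s" if uv: "(u, v) \<in> r" for u v
  proof (rule ccontr)
    assume no: "(g u, g v) \<notin> s"
    have A_uv: "u \<in> A" "v \<in> A" using linear_order_onD(2,3)[OF A(2) uv] by blast+
    then have gB: "g u \<in> B" "g v \<in> B" using bij by (auto simp: bij_betw_def)
    then have "(g v, g u) \<in> s" "g v \<noteq> g u"
      using no linear_order_onD(1,6)[OF B(2)] by metis+
    then have "order_rank r v < order_rank r u"
      using rank_mono[OF B] rank_g A_uv by metis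
    then show False
      using rank_mono[OF A uv] by fastforce
  qed
  then have "g \<in> extensional A \<and> bij_betw g A B \<and> (\<forall>(u, v) \<in> r. (g u, g v) \<in> s)"
    using bij ext by auto
  then show "\<exists>f. f \<in> extensional A \<and> bij_betw f A B \<and> (\<forall>(u, v) \<in> r. (f u, f v) \<in> s)" by (intro exI[of _ g])
  fix f h
  assume f: "f \<in> extensional A \<and> bij_betw f A B \<and> (\<forall>(u, v) \<in> r. (f u, f v) \<in> s)"
    and h: "h \<in> extensional A \<and> bij_betw h A B \<and> (\<forall>(u, v) \<in> r. (h u, h v) \<in> s)"
  show "f = h"
  proof (rule extensionalityI[of _ A])
    fix a assume a: "a \<in> A"
    have "order_rank s (f a) = order_rank r a"
      by (rule rank_order_iso[OF A(2) B(2) _ _ a]) (use f in auto)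
    moreover have "order_rank s (h a) = order_rank r a"
      by (rule rank_order_iso[OF A(2) B(2) _ _ a]) (use h in auto)
    ultimately have "order_rank s (f a) = order_rank s (h a)" by simp
    moreover have "f a \<in> B" "h a \<in> B"
      using f h a by (auto simp: bij_betw_def)
    ultimately show "f a = h a"
      using rB by (auto simp: bij_betw_def dest: inj_onD)
  qed (use f h in auto)
qed

text \<open>\<open>InL\<close> is injective but misses every \<open>InR\<close> value. Hence sets of
  each finite size exist whatever the type of atoms is.\<close>

lemma infinite_elt: "infinite (UNIV :: 'a elt set)"
proof
  assume "finite (UNIV :: 'a elt set)"
  then have "surj (InL :: 'a elt \<Rightarrow> 'a elt)"
    by (rule finite_UNIV_inj_surj) (simp add: inj_def)
  then obtain y :: "'a elt" where "InR undefined = InL y" by (metis surjD)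
  then show False by simp
qed

section \<open>The series of \<open>Z^k\<close> and of polynomials in \<open>Z\<close>\<close>

lemma hom_Z:
  "hom (stuff_Z k) (A, r) (B, s) =
    (if (A, r) \<in> obj (stuff_Z k) \<and> (B, s) \<in> obj (stuff_Z k)
     then (\<lambda>f. ((A, r), f, (B, s))) ` {f. f \<in> extensional A \<and> bij_betw f A B \<and> (\<forall>(u, v) \<in> r. (f u, f v) \<in> s)}
     else {})"
  by (auto simp: hom_def stuff_Z_def)

lemma category_Z: "category (stuff_Z k :: (_, _, 'a) stuff)"
proof -
  let ?Z = "stuff_Z k :: (_, _, 'a) stuff"
  have obj: "(A, r) \<in> obj ?Z \<longleftrightarrow> finite A \<and> card A = k \<and> linear_order_on A r" for A r
    by (simp add: stuff_Z_def)
  have idn: "idn ?Z (A, r) = ((A, r), restrict (\<lambda>u. u) A, (A, r))" for A r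
    by (simp add: stuff_Z_def)
  have cmp: "cmp ?Z (Y, g, Z) ((A, r), f, Y') = ((A, r), compose A g f, Z)" for Y g Z A r f Y'
    by (simp add: stuff_Z_def)
  show ?thesis
  proof
    show "src ?Z f \<in> obj ?Z" "tgt ?Z f \<in> obj ?Z" if "f \<in> arr ?Z" for f
      using that by (auto simp: stuff_Z_def)
    show "idn ?Z x \<in> hom ?Z x x" if "x \<in> obj ?Z" for x
    proof (cases x)
      case (Pair A r)
      have "bij_betw (restrict (\<lambda>u. u) A) A A"
        by (simp add: bij_betw_def)
      then show ?thesis
        using that linear_order_onD(2,3)[of A r] unfolding Pair hom_Z idn by (auto simp: obj)
    qed
    show "cmp ?Z g f \<in> hom ?Z x z" if fg: "f \<in> hom ?Z x y" "g \<in> hom ?Z y z" for f g x y z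
    proof (cases x; cases y; cases z)
      fix A r B s C t assume xyz: "x = (A, r)" "y = (B, s)" "z = (C, t)"
      obtain f' where f': "f = ((A, r), f', (B, s))" "f' \<in> extensional A" "bij_betw f' A B"
        "\<forall>(u, v) \<in> r. (f' u, f' v) \<in> s" and r: "(A, r) \<in> obj ?Z"
        using fg(1) unfolding xyz hom_Z by (auto split: if_splits)
      obtain g' where g': "g = ((B, s), g', (C, t))" "g' \<in> extensional B" "bij_betw g' B C"
        "\<forall>(u, v) \<in> s. (g' u, g' v) \<in> t" and t: "(C, t) \<in> obj ?Z"
        using fg(2) unfolding xyz hom_Z by (auto split: if_splits)
      have "bij_betw (compose A g' f') A C"
        using bij_betw_trans[OF f'(3) g'(3)] by (simp add: compose_def o_def cong: bij_betw_cong)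
      \<comment> \<open>\<open>compose\<close> is undefined off \<open>A\<close>; the order
        \<open>r\<close> relates only elements of \<open>A\<close>, so this does no harm.\<close>
      moreover have "\<forall>(u, v) \<in> r. (compose A g' f' u, compose A g' f' v) \<in> t"
        using f'(4) g'(4) linear_order_onD(2,3)[of A r] r by (fastforce simp: compose_eq obj)
      ultimately show ?thesis
        unfolding xyz f' g' cmp hom_Z using r t by auto
    qed
    show "cmp ?Z f (idn ?Z x) = f" if "f \<in> hom ?Z x y" for f x y
      using that by (cases x; cases y) (auto simp: hom_Z idn cmp compose_def extensional_def fun_eq_iff split: if_splits)
    show "cmp ?Z (idn ?Z y) f = f" if "f \<in> hom ?Z x y" for f x y
      using that
      by (cases x; cases y) (auto simp: hom_Z idn cmp compose_def extensional_def fun_eq_iff bij_betw_def split: if_splits)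
    show "cmp ?Z h (cmp ?Z g f) = cmp ?Z (cmp ?Z h g) f"
      if "f \<in> hom ?Z w x" "g \<in> hom ?Z x y" "h \<in> hom ?Z y z" for f g h w x y z
      using that
      by (cases w; cases x; cases y; cases z)
        (auto simp: hom_Z cmp compose_def fun_eq_iff bij_betw_def split: if_splits)
  qed
qed

text \<open>Rigidity comes from the unique order isomorphism. An object is still required, for
  otherwise the series would be 0: the infinite type supplies a set of size \<open>k\<close>, and a
  well-order on it is a linear order.\<close>

lemma has_series_Z: "has_series (stuff_Z k :: (_, _, 'a) stuff) (fps_X ^ k)"
proof -
  obtain A :: "'a elt set" where A: "finite A" "card A = k"
    using infinite_arbitrarily_large[OF infinite_elt] by blast
  obtain r where "well_order_on A r"
    using well_order_on by blast
  then have "(A, r) \<in> obj (stuff_Z k)"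
    using A by (simp add: stuff_Z_def well_order_on_def)
  moreover have "\<exists>!f. f \<in> hom (stuff_Z k :: (_, _, 'a) stuff) x y"
    if xy: "x \<in> obj (stuff_Z k :: (_, _, 'a) stuff)" "y \<in> obj (stuff_Z k :: (_, _, 'a) stuff)" for x y
  proof (cases x; cases y)
    fix A r B s assume eq: "x = (A, r)" "y = (B, s)"
    have "\<exists>!f. f \<in> extensional A \<and> bij_betw f A B \<and> (\<forall>(u, v) \<in> r. (f u, f v) \<in> s)"
      using xy by (intro ex1_order_iso) (auto simp: eq stuff_Z_def)
    then show ?thesis
      unfolding eq hom_Z using xy[unfolded eq] by (simp only: simp_thms if_True image_iff mem_Collect_eq bex_simps) blast
  qed
  ultimately show ?thesis
    by (intro has_series_rigid[OF category_Z]) (auto simp: stuff_Z_def)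
qed

lemma has_series_poly:
  "has_series (stuff_poly p) (\<Sum>k\<le>degree p. of_nat (coeff p k) * fps_X ^ k)"
proof -
  have copies: "has_series (stuff_copies c G) (of_nat c * a)" if "has_series G a" for c a and G :: "('x, 'y, 'z) stuff"
    using has_series_sum[of "{..<c}" "\<lambda>_. G" "\<lambda>_. a"] that by (simp add: stuff_copies_def)
  have "has_series (stuff_poly p) (of_nat (coeff p 0) * 1 + (\<Sum>k\<in>{1..degree p}. of_nat (coeff p k) * fps_X ^ k))"
    unfolding stuff_poly_def
    by (intro has_series_plus has_series_sum copies has_series_one has_series_Z) simp
  \<comment> \<open>\<open>stuff_poly\<close> treats the constant term separately, with
    \<open>stuff_one\<close>; as \<open>fps_X ^ 0 = 1\<close>, it rejoins the sum as the term
    \<open>k = 0\<close>.\<close>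
  also have "of_nat (coeff p 0) * 1 + (\<Sum>k\<in>{1..degree p}. of_nat (coeff p k) * fps_X ^ k) =
      (\<Sum>k\<le>degree p. of_nat (coeff p k) * fps_X ^ k :: real fps)"
    by (simp add: atMost_atLeast0 sum.atLeast_Suc_atMost)
  finally show ?thesis .
qed

lemma has_series_nested_target:
  assumes "has_series G a"
  shows "has_series (nested_target m p G)
    (\<Sum>i\<le>m. (\<Sum>k\<le>degree (p i). of_nat (coeff (p i) k) * fps_X ^ k) * a ^ i)"
proof -
  have "has_series (nested_target m p G) ((\<Sum>k\<le>degree (p 0). of_nat (coeff (p 0) k) * fps_X ^ k) +
      (\<Sum>i\<in>{1..m}. (\<Sum>k\<le>degree (p i). of_nat (coeff (p i) k) * fps_X ^ k) * a ^ i))"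
    unfolding nested_target_def
    by (intro has_series_plus has_series_sum has_series_poly has_series_times has_series_power assms) simp
  then show ?thesis
    by (simp add: atMost_atLeast0 sum.atLeast_Suc_atMost)
qed

section \<open>Analytic continuation of a polynomial equation\<close>

text \<open>The error \<open>Q t\<close> of the equation is a polynomial expression in the germ
  \<open>f t\<close>, hence itself continues along the path. Whether it vanishes near \<gamma> t is
  locally constant in \<open>t\<close>, so by connectedness of the interval it vanishes at the end
  as it does at the start.\<close>

lemma continuation_value_satisfies:
  fixes q :: "nat \<Rightarrow> complex poly"
  assumes cv: "continuation_value g v"
    and eq: "\<forall>\<^sub>F z in nhds 0. g z = (\<Sum>i\<le>m. poly (q i) z * g z ^ i)"
  shows "v = (\<Sum>i\<le>m. poly (q i) 1 * v ^ i)"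
proof -
  obtain \<gamma> f where cont: "continuation_along g \<gamma> f" and \<gamma>: "pathstart \<gamma> = 0" "pathfinish \<gamma> = 1" "f 1 1 = v"
    using cv unfolding continuation_value_def by blast
  have path: "continuous_on {0..1} \<gamma>"
    and ana: "\<And>t. t \<in> {0..1} \<Longrightarrow> f t analytic_on {\<gamma> t}"
    and start: "\<forall>\<^sub>F z in nhds 0. f 0 z = g z"
    and loc: "\<And>t. t \<in> {0..1} \<Longrightarrow> \<exists>\<delta>>0. \<forall>s\<in>{0..1}. \<bar>s - t\<bar> < \<delta> \<longrightarrow> (\<forall>\<^sub>F z in nhds (\<gamma> s). f s z = f t z)"
    using cont \<gamma> by (auto simp: continuation_along_def path_def)
  define Q where "Q t z = f t z - (\<Sum>i\<le>m. poly (q i) z * f t z ^ i)" for t z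
  define P where "P t \<longleftrightarrow> (\<forall>\<^sub>F z in nhds (\<gamma> t). Q t z = 0)" for t
  have "P 1"
  proof (rule connected_induction_simple[of "{0..1::real}" 0 1 P])
    have "\<forall>\<^sub>F z in nhds 0. Q 0 z = 0"
      using eventually_conj[OF start eq] by (rule eventually_mono) (auto simp: Q_def)
    then show "P 0"
      using \<gamma>(1) by (simp add: P_def pathstart_def)
    fix t :: real assume t: "t \<in> {0..1}"
    obtain r where r: "r > 0" "f t holomorphic_on ball (\<gamma> t) r"
      using ana[OF t] by (auto simp: analytic_on_def)
    have hol: "Q t holomorphic_on ball (\<gamma> t) r"
      unfolding Q_def using r(2) by (intro holomorphic_intros)
    obtain \<delta> where \<delta>: "\<delta> > 0" "\<And>s. s \<in> {0..1} \<Longrightarrow> \<bar>s - t\<bar> < \<delta> \<Longrightarrow> \<forall>\<^sub>F z in nhds (\<gamma> s). f s z = f t z"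
      using loc[OF t] by blast
    obtain \<delta>' where \<delta>': "\<delta>' > 0" "\<And>s. s \<in> {0..1} \<Longrightarrow> dist s t < \<delta>' \<Longrightarrow> dist (\<gamma> s) (\<gamma> t) < r"
      using path t r(1) unfolding continuous_on_iff by metis
    \<comment> \<open>Within \<delta> the germs of \<open>f x\<close> and \<open>f t\<close> at
      \<gamma> x agree; within \<open>\<delta>'\<close> the point \<gamma> x stays in the ball where
      \<open>f t\<close> is holomorphic.\<close>
    define T where "T = {0..1} \<inter> ball t (min \<delta> \<delta>')"
    \<comment> \<open>The right-hand side does not mention \<open>x\<close>, so \<open>P\<close> is
      constant on \<open>T\<close>. For the forward direction, \<open>Q t\<close> vanishes on an
      open set around \<gamma> x, and the identity theorem spreads this over the connected
      ball.\<close>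
    have "P x \<longleftrightarrow> (\<forall>z\<in>ball (\<gamma> t) r. Q t z = 0)" if "x \<in> T" for x
    proof -
      have x: "x \<in> {0..1}" "\<bar>x - t\<bar> < \<delta>" "dist x t < \<delta>'"
        using that by (auto simp: T_def dist_real_def)
      have in_ball: "\<gamma> x \<in> ball (\<gamma> t) r"
        using \<delta>'(2)[OF x(1,3)] by (simp add: dist_commute)
      have same: "\<forall>\<^sub>F z in nhds (\<gamma> x). Q x z = Q t z"
        using \<delta>(2)[OF x(1,2)] by (rule eventually_mono) (simp add: Q_def)
      show ?thesis
      proof
        assume "P x"
        then have "\<forall>\<^sub>F z in nhds (\<gamma> x). Q t z = 0"
          using same unfolding P_def by eventually_elim simp
        then obtain U where U: "open U" "\<gamma> x \<in> U" "\<And>z. z \<in> U \<Longrightarrow> Q t z = 0"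
          unfolding eventually_nhds by blast
        have "Q t z = 0" if "z \<in> ball (\<gamma> t) r" for z
          by (rule analytic_continuation_open[of "U \<inter> ball (\<gamma> t) r" "ball (\<gamma> t) r" "Q t" "\<lambda>_. 0"])
            (use U in_ball hol that in auto)
        then show "\<forall>z\<in>ball (\<gamma> t) r. Q t z = 0" by blast
      next
        assume zero: "\<forall>z\<in>ball (\<gamma> t) r. Q t z = 0"
        have "\<forall>\<^sub>F z in nhds (\<gamma> x). z \<in> ball (\<gamma> t) r"
          using in_ball by (intro eventually_nhds_in_open) auto
        then show "P x"
          using same unfolding P_def by eventually_elim (use zero in simp)
      qed
    qed
    moreover have "openin (top_of_set {0..1}) T" "t \<in> T"
      using t \<delta>(1) \<delta>'(1) by (auto simp: T_def)
    ultimately show "\<exists>T. openin (top_of_set {0..1}) T \<and> t \<in> T \<and> (\<forall>x\<in>T. \<forall>y\<in>T. P x \<longrightarrow> P y)"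
      by blast
  qed auto
  \<comment> \<open>A property holding near the endpoint holds at the endpoint, which is 1.\<close>
  then have "Q 1 1 = 0"
    using \<gamma>(2) eventually_nhds_x_imp_x by (fastforce simp: P_def pathfinish_def)
  then show ?thesis
    using \<gamma>(3) by (simp add: Q_def)
qed

section \<open>From real counting series to complex analytic functions\<close>

definition fps_complex_of_real :: "real fps \<Rightarrow> complex fps" where
  "fps_complex_of_real a = Abs_fps (\<lambda>n. of_real (fps_nth a n))"

lemma fps_complex_of_real_nth [simp]: "fps_nth (fps_complex_of_real a) n = of_real (fps_nth a n)"
  by (simp add: fps_complex_of_real_def)

text \<open>The weights are summed in the reals, while \<open>gen_series\<close> and its
  continuation are complex; these ring homomorphism laws move the series equation across.\<close>

lemma fps_complex_of_real_hom:
  "fps_complex_of_real 0 = 0" "fps_complex_of_real 1 = 1"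
  "fps_complex_of_real (a + b) = fps_complex_of_real a + fps_complex_of_real b"
  "fps_complex_of_real (a * b) = fps_complex_of_real a * fps_complex_of_real b"
  "fps_complex_of_real fps_X = fps_X"
  by (auto simp: fps_eq_iff fps_mult_nth fps_X_def)

lemma fps_complex_of_real_power: "fps_complex_of_real (a ^ k) = fps_complex_of_real a ^ k"
  by (induction k) (simp_all add: fps_complex_of_real_hom)

lemma fps_complex_of_real_of_nat: "fps_complex_of_real (of_nat k) = of_nat k"
  by (induction k) (simp_all add: fps_complex_of_real_hom)

lemma fps_complex_of_real_sum: "fps_complex_of_real (\<Sum>i\<in>I. a i) = (\<Sum>i\<in>I. fps_complex_of_real (a i))"
  by (induction I rule: infinite_finite_induct) (simp_all add: fps_complex_of_real_hom)

lemma gen_series_nested: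
  assumes G: "stuff_type G" "relatively_tame G" and nested: "nested_equivalence G m p T \<tau>"
  shows "gen_series G = (\<Sum>i\<le>m. fps_of_poly (map_poly of_nat (p i)) * gen_series G ^ i)"
proof -
  define a where "a = Abs_fps (\<lambda>n. enn2real (groupoid_card (graded G n)))"
  have a: "has_series G a"
    unfolding a_def using G by (rule stuff_type_has_series)
  have "a = (\<Sum>i\<le>m. (\<Sum>k\<le>degree (p i). of_nat (coeff (p i) k) * fps_X ^ k) * a ^ i)"
    by (rule has_series_unique[OF _ a has_series_nested_target[OF a]])
      (use nested in \<open>unfold nested_equivalence_def, blast\<close>)
  then have "fps_complex_of_real a =
      fps_complex_of_real (\<Sum>i\<le>m. (\<Sum>k\<le>degree (p i). of_nat (coeff (p i) k) * fps_X ^ k) * a ^ i)"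
    by (rule arg_cong)
  also have "\<dots> = (\<Sum>i\<le>m. (\<Sum>k\<le>degree (p i). of_nat (coeff (p i) k) * fps_X ^ k) * fps_complex_of_real a ^ i)"
    by (simp add: fps_complex_of_real_hom fps_complex_of_real_power fps_complex_of_real_of_nat
        fps_complex_of_real_sum)
  also have "(\<lambda>i. \<Sum>k\<le>degree (p i). of_nat (coeff (p i) k) * fps_X ^ k) =
      (\<lambda>i. fps_of_poly (map_poly of_nat (p i)) :: complex fps)"
  proof (intro ext fps_ext)
    fix i n
    have "fps_nth (\<Sum>k\<le>degree (p i). of_nat (coeff (p i) k) * fps_X ^ k :: complex fps) n =
        (\<Sum>k\<le>degree (p i). if n = k then of_nat (coeff (p i) k) else 0)"
      unfolding fps_sum_nth by (rule sum.cong) (simp_all add: fps_of_nat[symmetric])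
    also have "\<dots> = of_nat (coeff (p i) n)"
      \<comment> \<open>For \<open>n\<close> above the degree the sum has no matching term and is 0,
        in agreement with the vanishing coefficient.\<close>
      by (subst sum.delta') (auto simp: coeff_eq_0)
    finally show "fps_nth (\<Sum>k\<le>degree (p i). of_nat (coeff (p i) k) * fps_X ^ k) n =
        fps_nth (fps_of_poly (map_poly of_nat (p i)) :: complex fps) n"
      by (simp only: fps_of_poly_nth coeff_map_poly of_nat_0)
  qed
  also have "fps_complex_of_real a = gen_series G"
    by (simp add: gen_series_def a_def fps_complex_of_real_def)
  finally show ?thesis by simp
qed

text \<open>The two claims are proved together because \<open>eval_fps_add\<close> in the induction
  step needs \<open>z\<close> to lie inside the disc of convergence of the remaining sum.\<close>

lemma eval_fps_sum:
  fixes F :: "'i \<Rightarrow> 'a :: {banach, real_normed_field} fps"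
  assumes "\<And>i. i \<in> I \<Longrightarrow> ereal (norm z) < fps_conv_radius (F i)"
  shows "eval_fps (\<Sum>i\<in>I. F i) z = (\<Sum>i\<in>I. eval_fps (F i) z) \<and>
    (finite I \<longrightarrow> ereal (norm z) < fps_conv_radius (\<Sum>i\<in>I. F i))"
  using assms
proof (induction I rule: infinite_finite_induct)
  case (insert i I)
  then have IH: "eval_fps (\<Sum>i\<in>I. F i) z = (\<Sum>i\<in>I. eval_fps (F i) z)"
    "ereal (norm z) < fps_conv_radius (\<Sum>i\<in>I. F i)" by auto
  have "ereal (norm z) < min (fps_conv_radius (F i)) (fps_conv_radius (\<Sum>i\<in>I. F i))"
    using IH insert.prems by simp
  also have "\<dots> \<le> fps_conv_radius (F i + (\<Sum>i\<in>I. F i))"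
    by (rule fps_conv_radius_add)
  finally show ?case
    using insert IH by (simp add: eval_fps_add)
qed auto

text \<open>Polynomials converge everywhere and powers of \<open>g\<close> at least where
  \<open>g\<close> does, so the formal identity may be evaluated term by term in the disc of
  convergence of \<open>g\<close>.\<close>

lemma eval_gen_series_nested:
  fixes g :: "complex fps"
  assumes g: "g = (\<Sum>i\<le>m. fps_of_poly (q i) * g ^ i)" and z: "ereal (norm z) < fps_conv_radius g"
  shows "eval_fps g z = (\<Sum>i\<le>m. poly (q i) z * eval_fps g z ^ i)"
proof -
  have pow: "ereal (norm z) < fps_conv_radius (g ^ i)" for i
    using z fps_conv_radius_power[of g i] by (rule less_le_trans)
  have rad: "ereal (norm z) < fps_conv_radius (fps_of_poly (q i) * g ^ i)" for i
  proof -
    have "ereal (norm z) < min (fps_conv_radius (fps_of_poly (q i))) (fps_conv_radius (g ^ i))"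
      using pow by simp
    also have "\<dots> \<le> fps_conv_radius (fps_of_poly (q i) * g ^ i)"
      by (rule fps_conv_radius_mult)
    finally show ?thesis .
  qed
  have "eval_fps g z = eval_fps (\<Sum>i\<le>m. fps_of_poly (q i) * g ^ i) z"
    using g by simp
  also have "\<dots> = (\<Sum>i\<le>m. eval_fps (fps_of_poly (q i) * g ^ i) z)"
    using eval_fps_sum[of "{..m}" z "\<lambda>i. fps_of_poly (q i) * g ^ i"] rad by blast
  also have "\<dots> = (\<Sum>i\<le>m. poly (q i) z * eval_fps g z ^ i)"
    using pow z by (simp add: eval_fps_mult eval_fps_power)
  finally show ?thesis .
qed

theorem theorem5p6:
  fixes G :: "('o, 'm, 'a) stuff" and m :: nat and p :: "nat \<Rightarrow> nat poly"
  assumes "stuff_type G"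
    and "analytically_tame G"
    and "nested_equivalence G m p T \<tau>"
  shows "analytic_card G = poly (map_poly of_int (structural_poly m p)) (analytic_card G)"
proof -
  define g where "g = gen_series G"
  define q where "q i = (map_poly of_nat (p i) :: complex poly)" for i
  define v where "v = analytic_card G"
  have tame: "relatively_tame G" "fps_conv_radius g > 0" "\<exists>!v. continuation_value (eval_fps g) v"
    using assms(2) by (auto simp: analytically_tame_def g_def)
  \<comment> \<open>Unique existence makes the definite description in \<open>analytic_card\<close>
    a genuine continuation value, witnessed by some path and germs along it.\<close>
  have v: "continuation_value (eval_fps g) v"
    unfolding v_def analytic_card_def g_def[symmetric] by (rule theI'[OF tame(3)])
  have g: "g = (\<Sum>i\<le>m. fps_of_poly (q i) * g ^ i)"
    unfolding g_def q_def by (rule gen_series_nested[OF assms(1) tame(1) assms(3)])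
  have "\<forall>\<^sub>F z in nhds 0. z \<in> eball 0 (fps_conv_radius g)"
    using tame(2) by (intro eventually_nhds_in_open) (auto simp: zero_ereal_def)
  then have "\<forall>\<^sub>F z in nhds 0. eval_fps g z = (\<Sum>i\<le>m. poly (q i) z * eval_fps g z ^ i)"
    by eventually_elim (rule eval_gen_series_nested[OF g], simp add: in_eball_iff)
  then have "v = (\<Sum>i\<le>m. poly (q i) 1 * v ^ i)"
    by (rule continuation_value_satisfies[OF v])
  \<comment> \<open>Coefficients reach the complex numbers directly in \<open>q\<close>, but through
    the integers in \<open>structural_poly\<close>; at 1 both routes give the same value.\<close>
  moreover have "poly (q i) 1 = of_int (int (poly (p i) 1))" for i
    by (simp add: q_def poly_altdef degree_map_poly coeff_map_poly)
  moreover have "poly (map_poly of_int (structural_poly m p)) v = (\<Sum>i\<le>m. of_int (int (poly (p i) 1)) * v ^ i)"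
  proof -
    have "map_poly of_int (structural_poly m p) = (\<Sum>i\<le>m. monom (of_int (int (poly (p i) 1)) :: complex) i)"
      by (rule poly_eqI) (auto simp: structural_poly_def coeff_map_poly coeff_sum intro!: sum.cong)
    then show ?thesis
      by (simp add: poly_sum poly_monom)
  qed
  ultimately show ?thesis
    unfolding v_def by simp
qed

end
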